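(* Let $n\ge p\ge1$ be integers, $\sigma^2>0$, and let $M=PD_mQ^{T}\in\mathbb R^{p\times n}$ where $P$ and $Q$ are orthogonal matrices of order $p$ and $n$ respectively and $D_m$ is the $p\times n$ rectangular diagonal matrix with entries $m_1,\dots,m_p$ in the positions $(1,1),\dots,(p,p)$ and zeros elsewhere. Let $\mathcal X\equiv\mathcal N_{p,n}(M,\sigma^2I_p,I_n)$ be a normal umbral matrix and let $W=W_p(n,\sigma^2I_p,M)$ be the non-central Wishart random matrix. Let $\Delta_p=\mathrm{diag}(\delta_1,\dots,\delta_p)$ and $\tilde\Delta_n=\mathrm{diag}(\tilde\delta_1,\dots,\tilde\delta_n)$ be diagonal matrices of distinct delta umbrae, uncorrelated with each other and with the umbrae occurring in $\mathcal X$. Then for every integer $0\le i\le p$, $$i!\,\mathbb E[\mathrm{Tr}_i(W)]=E\left\{\big(\mathrm{Tr}[(\Delta_pP^{T}\mathcal XQ\tilde\Delta_n)(\Delta_pP^{T}\mathcal XQ\tilde\Delta_n)^{T}]\big)^i\right\}.$$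
   Context: $\mathbb E$ is ordinary expectation. $\mathrm{Tr}_i(S)=e_i(Y_1,\dots,Y_p)$ is the $i$-th elementary symmetric function of the eigenvalues (latent roots) $Y_1,\dots,Y_p$ of a $p\times p$ matrix $S$, with $e_0=1$. The Wishart matrix $W_p(n,\Sigma,M)$ is $\mathsf X\mathsf X^{T}$ where $\mathsf X$ is a $p\times n$ random matrix ($n\ge p$) with independent columns, the $j$-th column being Gaussian with mean the $j$-th column of $M$ and covariance $\Sigma$. Umbral calculus: let $\mathcal A$ be a set of commuting formal symbols (umbrae) and $E$ a linear functional on $\mathbb R[\mathcal A]$ with $E[1]=1$ and $E(\alpha^i\gamma^j\cdots)=E(\alpha^i)E(\gamma^j)\cdots$ for distinct umbrae $\alpha,\gamma,\dots$ (distinct umbrae are uncorrelated). A delta umbra $\delta$ has generating function $E[e^{\delta z}]=1+z^2/2$, i.e. $E(\delta^k)=1$ for $k\in\{0,2\}$ and $E(\delta^k)=0$ otherwise. Normal umbral matrix: $\mathcal X\equiv\mathcal N_{p,n}(M,\Sigma,I_n)$ is a $p\times n$ matrix of elements of $\mathbb R[\mathcal A]$ with $E[\exp\mathrm{Tr}(\mathcal X^{T}Z)]=\exp\big[\mathrm{vec}(M)^{T}\mathrm{vec}(Z)+\tfrac12\mathrm{vec}(Z)^{T}(I_n\otimes\Sigma)\mathrm{vec}(Z)\big]$; equivalently, the joint moments of its entries under $E$ equal those of the entries of the random matrix $\mathsf X$ above. *)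

theory Defs
  imports
    "HOL-Probability.Probability"
    "HOL-Library.Poly_Mapping"
    "HOL-Computational_Algebra.Formal_Power_Series"
    "Jordan_Normal_Form.Char_Poly"
begin

text \<open>Matrices and vectors are those of Jordan_Normal_Form, so all indices start at 0.\<close>

hide_type (open) Finite_Cartesian_Product.vec
hide_const (open) Finite_Cartesian_Product.vec Finite_Cartesian_Product.mat
  Finite_Cartesian_Product.row Finite_Cartesian_Product.transpose
  Determinants.det Cartesian_Space.vector
unbundle no vec_syntax
unbundle no inner_syntax


subsection \<open>Matrices\<close>

definition mtrace :: "'a::comm_monoid_add mat \<Rightarrow> 'a" where
  "mtrace A = (\<Sum>k<dim_row A. A $$ (k, k))"

text \<open>The constant \<^const>\<open>orthogonal_mat\<close> of Jordan_Normal_Form does not normalise the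
  columns, so it is not the notion needed here.\<close>

definition orthogonal_of_order :: "nat \<Rightarrow> real mat \<Rightarrow> bool" where
  "orthogonal_of_order k P \<longleftrightarrow>
     P \<in> carrier_mat k k \<and> P * P\<^sup>T = 1\<^sub>m k \<and> P\<^sup>T * P = 1\<^sub>m k"

definition rect_diag :: "nat \<Rightarrow> nat \<Rightarrow> (nat \<Rightarrow> real) \<Rightarrow> real mat" where
  "rect_diag p n m = Matrix.mat p n (\<lambda>(i, j). if i = j then m i else 0)"

text \<open>Column stacking.\<close>

definition vectorize :: "'a mat \<Rightarrow> 'a vec" where
  "vectorize A =
     Matrix.vec (dim_row A * dim_col A) (\<lambda>k. A $$ (k mod dim_row A, k div dim_row A))"

definition kronecker :: "'a::times mat \<Rightarrow> 'a mat \<Rightarrow> 'a mat" where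
  "kronecker A B = Matrix.mat (dim_row A * dim_row B) (dim_col A * dim_col B)
     (\<lambda>(i, j). A $$ (i div dim_row B, j div dim_col B) * B $$ (i mod dim_row B, j mod dim_col B))"

definition elem_sym :: "nat \<Rightarrow> 'a::comm_semiring_1 list \<Rightarrow> 'a" where
  "elem_sym i ys = (\<Sum>J | J \<subseteq> {..<length ys} \<and> card J = i. \<Prod>j\<in>J. ys ! j)"

text \<open>The latent roots are taken in the complex numbers, with multiplicity. Their enumeration is
  arbitrary, which is harmless as they only enter symmetrically.\<close>

definition latent_roots :: "real mat \<Rightarrow> complex list" where
  "latent_roots S = (SOME ys. mset ys = proots (char_poly (map_mat complex_of_real S)))"

definition Tr_sym :: "nat \<Rightarrow> real mat \<Rightarrow> complex" where
  "Tr_sym i S = elem_sym i (latent_roots S)"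


subsection \<open>Gaussian random matrices and the Wishart distribution\<close>

text \<open>The normal law with mean \<open>\<mu>\<close> and variance \<open>v\<close>, a point mass when \<open>v = 0\<close>. Note that
  \<^const>\<open>normal_density\<close> takes the standard deviation.\<close>

definition normal_rv :: "'w measure \<Rightarrow> ('w \<Rightarrow> real) \<Rightarrow> real \<Rightarrow> real \<Rightarrow> bool" where
  "normal_rv \<Omega> Y \<mu> v \<longleftrightarrow> Y \<in> borel_measurable \<Omega> \<and> 0 \<le> v \<and>
     distr \<Omega> borel Y =
       (if v = 0 then return borel \<mu> else density lborel (normal_density \<mu> (sqrt v)))"

text \<open>A random vector is Gaussian with mean \<open>\<mu>\<close> and covariance matrix \<open>\<Sigma>\<close> iff every linear
  form \<open>a \<bullet> x\<close> in it is normal with mean \<open>a \<bullet> \<mu>\<close> and variance \<open>a \<bullet> \<Sigma> a\<close>.\<close>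

definition gaussian_vector ::
    "'w measure \<Rightarrow> nat \<Rightarrow> real vec \<Rightarrow> real mat \<Rightarrow> ('w \<Rightarrow> real vec) \<Rightarrow> bool" where
  "gaussian_vector \<Omega> p \<mu> \<Sigma> x \<longleftrightarrow>
     \<mu> \<in> carrier_vec p \<and> \<Sigma> \<in> carrier_mat p p \<and> \<Sigma>\<^sup>T = \<Sigma> \<and>
     (\<forall>\<omega>\<in>space \<Omega>. x \<omega> \<in> carrier_vec p) \<and>
     (\<forall>a\<in>carrier_vec p. normal_rv \<Omega> (\<lambda>\<omega>. a \<bullet> x \<omega>) (a \<bullet> \<mu>) (a \<bullet> (\<Sigma> *\<^sub>v a)))"

text \<open>Independence of the columns is stated in the product space of \<open>p\<close> copies of the real line.\<close>

definition gaussian_matrix ::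
    "'w measure \<Rightarrow> nat \<Rightarrow> nat \<Rightarrow> real mat \<Rightarrow> real mat \<Rightarrow> ('w \<Rightarrow> real mat) \<Rightarrow> bool" where
  "gaussian_matrix \<Omega> p n M \<Sigma> X \<longleftrightarrow>
     prob_space \<Omega> \<and> M \<in> carrier_mat p n \<and>
     (\<forall>\<omega>\<in>space \<Omega>. X \<omega> \<in> carrier_mat p n) \<and>
     (\<forall>j<n. gaussian_vector \<Omega> p (col M j) \<Sigma> (\<lambda>\<omega>. col (X \<omega>) j)) \<and>
     prob_space.indep_vars \<Omega> (\<lambda>_. \<Pi>\<^sub>M i\<in>{..<p}. (borel :: real measure))
       (\<lambda>j \<omega>. \<lambda>i\<in>{..<p}. X \<omega> $$ (i, j)) {..<n}"

definition wishart ::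
    "'w measure \<Rightarrow> nat \<Rightarrow> nat \<Rightarrow> real mat \<Rightarrow> real mat \<Rightarrow> ('w \<Rightarrow> real mat) \<Rightarrow> bool" where
  "wishart \<Omega> p n \<Sigma> M W \<longleftrightarrow> p \<le> n \<and>
     (\<exists>X. gaussian_matrix \<Omega> p n M \<Sigma> X \<and> (\<forall>\<omega>\<in>space \<Omega>. W \<omega> = X \<omega> * (X \<omega>)\<^sup>T))"


subsection \<open>Umbral calculus\<close>

text \<open>The polynomial ring over the reals in the umbrae \<open>'u\<close>: finitely supported families of
  real coefficients indexed by monomials, which are finitely supported exponent families.\<close>

type_synonym 'u umbral_poly = "('u \<Rightarrow>\<^sub>0 nat) \<Rightarrow>\<^sub>0 real"

definition uconst :: "real \<Rightarrow> 'u umbral_poly" where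
  "uconst c = Poly_Mapping.single 0 c"

definition umbra :: "'u \<Rightarrow> 'u umbral_poly" where
  "umbra u = Poly_Mapping.single (Poly_Mapping.single u 1) 1"

definition umbrae_of :: "'u umbral_poly \<Rightarrow> 'u set" where
  "umbrae_of x = (\<Union>m\<in>Poly_Mapping.keys x. Poly_Mapping.keys m)"

text \<open>The last conjunct says that distinct umbrae are uncorrelated.\<close>

definition umbral_evaluation :: "('u umbral_poly \<Rightarrow> real) \<Rightarrow> bool" where
  "umbral_evaluation E \<longleftrightarrow>
     (\<forall>x y. E (x + y) = E x + E y) \<and>
     (\<forall>c x. E (uconst c * x) = c * E x) \<and>
     E 1 = 1 \<and>
     (\<forall>m. E (Poly_Mapping.single m 1) =
        (\<Prod>u\<in>Poly_Mapping.keys m. E (umbra u ^ Poly_Mapping.lookup m u)))"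

text \<open>The generating function \<open>E[exp (x z)]\<close>, a formal power series in \<open>z\<close>.\<close>

definition umbral_gf :: "('u umbral_poly \<Rightarrow> real) \<Rightarrow> 'u umbral_poly \<Rightarrow> real fps" where
  "umbral_gf E x = Abs_fps (\<lambda>k. E (x ^ k) / fact k)"

definition delta_umbra :: "('u umbral_poly \<Rightarrow> real) \<Rightarrow> 'u \<Rightarrow> bool" where
  "delta_umbra E u \<longleftrightarrow> umbral_gf E (umbra u) = 1 + fps_const (1/2) * fps_X ^ 2"

text \<open>The normal umbral matrix \<open>N_{p,n}(M, \<Sigma>, I_n)\<close>. Its generating function
  \<open>E[exp Tr (X^T Z)] = exp (vec(M)^T vec(Z) + 1/2 vec(Z)^T (I_n \<otimes> \<Sigma>) vec(Z))\<close> is an identity of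
  formal power series in the entries of \<open>Z\<close>. It is written here with \<open>t Z\<close> in place of \<open>Z\<close>, where
  \<open>t\<close> (that is, \<^const>\<open>fps_X\<close>) is the formal variable and \<open>Z\<close> ranges over all real matrices:
  the coefficients of \<open>t^k\<close> are the homogeneous parts of degree \<open>k\<close>, as polynomial functions of
  \<open>Z\<close>.\<close>

definition normal_umbral_matrix ::
    "('u umbral_poly \<Rightarrow> real) \<Rightarrow> nat \<Rightarrow> nat \<Rightarrow> real mat \<Rightarrow> real mat \<Rightarrow> 'u umbral_poly mat \<Rightarrow> bool"
  where
  "normal_umbral_matrix E p n M \<Sigma> X \<longleftrightarrow>
     M \<in> carrier_mat p n \<and> \<Sigma> \<in> carrier_mat p p \<and> X \<in> carrier_mat p n \<and>
     (\<forall>Z\<in>carrier_mat p n.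
        umbral_gf E (mtrace (X\<^sup>T * map_mat uconst Z)) =
          fps_exp 1 oo
            (fps_const (vectorize M \<bullet> vectorize Z) * fps_X +
             fps_const (1/2 * (vectorize Z \<bullet> (kronecker (1\<^sub>m n) \<Sigma> *\<^sub>v vectorize Z))) * fps_X ^ 2))"

end

theory Submission
  imports Defs
begin

text \<open>By polarization, the joint moments of a family of commuting quantities are determined by the
  moments of its linear forms. The entries of \<open>P\<^sup>T X Q\<close>, random or umbral, have linear forms with
  the moments of a normal law whose mean is given by the diagonal matrix \<open>D\<close> and whose variance is
  \<open>\<sigma>\<^sup>2\<close> times the squared norm of the coefficients. Hence in both cases the joint moments are those of
  independent normal variables \<open>N(k, l)\<close> with means \<open>D(k, l)\<close> and variance \<open>\<sigma>\<^sup>2\<close>.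

  Expanding \<open>Tr_i(N N\<^sup>T)\<close> into principal minors and then over injections \<open>f\<close> and permutations \<open>\<pi>\<close>
  leaves in expectation only \<open>\<pi> = id\<close>, because \<open>D\<close> is diagonal. On the umbral side the delta umbrae
  retain in the \<open>i\<close>-th power of the trace exactly the products along \<open>i\<close> entries with distinct rows and
  distinct columns, each \<open>i!\<close> times. Both sides become \<open>i!\<close> times the sum over matchings \<open>G\<close> of size
  \<open>i\<close> of \<open>\<Prod>(k,l)\<in>G. D(k,l)\<^sup>2 + \<sigma>\<^sup>2\<close>.\<close>


subsection \<open>Polarization\<close>

text \<open>The summand depends on the image only, and each \<open>i\<close>-element subset of
  \<open>J\<close> is the image of exactly \<open>fact i\<close> injections. This one count supplies
  the factorial in the polarization identity and also the \<open>i!\<close> of the main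
  identity.\<close>

lemma sum_inj_PiE:
  fixes F :: "'a set \<Rightarrow> 'b::comm_semiring_1"
  assumes "finite J"
  shows "(\<Sum>g | g \<in> {..<i} \<rightarrow>\<^sub>E J \<and> inj_on g {..<i}. F (g ` {..<i}))
    = of_nat (fact i) * (\<Sum>G | G \<subseteq> J \<and> card G = i. F G)"
proof -
  let ?I = "{g. g \<in> {..<i} \<rightarrow>\<^sub>E J \<and> inj_on g {..<i}}"
  let ?S = "{G. G \<subseteq> J \<and> card G = i}"
  have fin: "finite ?I"
    by (rule finite_subset[OF _ finite_PiE[of "{..<i}" "\<lambda>_. J"]]) (use assms in auto)
  have fib: "(\<Sum>g | g \<in> ?I \<and> g ` {..<i} = G. F (g ` {..<i})) = of_nat (fact i) * F G" if G: "G \<in> ?S" for G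
  proof -
    have finG: "finite G" using G assms finite_subset by auto
    obtain h where h: "bij_betw h {..<i} G"
      using ex_bij_betw_nat_finite[OF finG] G by (auto simp: atLeast0LessThan)
    \<comment> \<open>Once an enumeration \<open>h\<close> of \<open>G\<close> is fixed, every other
      one is \<open>h\<close> after a permutation. Permutations are the identity from
      \<open>i\<close> on, whereas extensional functions are \<open>undefined\<close> there;
      \<open>restrict\<close> and the case distinction in the inverse translate between the two
      conventions.\<close>
    have "bij_betw (\<lambda>\<pi>. restrict (h \<circ> \<pi>) {..<i}) {\<pi>. \<pi> permutes {..<i}} {g \<in> ?I. g ` {..<i} = G}"
    proof (rule bij_betw_byWitness[where f' = "\<lambda>g k. if k < i then the_inv_into {..<i} h (g k) else k"])
      have inj: "inj_on h {..<i}" and im: "h ` {..<i} = G" using h by (auto simp: bij_betw_def)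
      show "\<forall>\<pi>\<in>{\<pi>. \<pi> permutes {..<i}}.
         (\<lambda>k. if k < i then the_inv_into {..<i} h (restrict (h \<circ> \<pi>) {..<i} k) else k) = \<pi>"
      proof (intro ballI ext)
        fix \<pi> k assume p: "\<pi> \<in> {\<pi>. \<pi> permutes {..<i}}"
        then have "\<pi> k < i" if "k < i" using permutes_in_image[of \<pi> "{..<i}" k] that by simp
        moreover have "\<pi> k = k" if "\<not> k < i" using p permutes_not_in[of \<pi> "{..<i}" k] that by simp
        ultimately show "(if k < i then the_inv_into {..<i} h (restrict (h \<circ> \<pi>) {..<i} k) else k) = \<pi> k"
          using the_inv_into_f_f[OF inj] by auto
      qed
      show "\<forall>g\<in>{g \<in> ?I. g ` {..<i} = G}.
         restrict (h \<circ> (\<lambda>k. if k < i then the_inv_into {..<i} h (g k) else k)) {..<i} = g"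
      proof (intro ballI ext)
        fix g k assume g: "g \<in> {g \<in> ?I. g ` {..<i} = G}"
        show "restrict (h \<circ> (\<lambda>k. if k < i then the_inv_into {..<i} h (g k) else k)) {..<i} k = g k"
        proof (cases "k < i")
          case True
          then have "g k \<in> h ` {..<i}" using g im by auto
          then show ?thesis using f_the_inv_into_f[OF inj] True by simp
        next
          case False
          then show ?thesis using g PiE_arb[of g "{..<i}" "\<lambda>_. J" k] by simp
        qed
      qed
      show "(\<lambda>\<pi>. restrict (h \<circ> \<pi>) {..<i}) ` {\<pi>. \<pi> permutes {..<i}} \<subseteq> {g \<in> ?I. g ` {..<i} = G}"
      proof (rule image_subsetI)
        fix \<pi> assume "\<pi> \<in> {\<pi>. \<pi> permutes {..<i}}"
        then have p: "\<pi> permutes {..<i}" by simp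
        have b: "bij_betw (restrict (h \<circ> \<pi>) {..<i}) {..<i} G"
          by (rule iffD2[OF bij_betw_cong bij_betw_trans[OF permutes_imp_bij[OF p] h]]) simp
        then have "restrict (h \<circ> \<pi>) {..<i} ` {..<i} \<subseteq> J" using G by (simp add: bij_betw_def)
        then have "restrict (h \<circ> \<pi>) {..<i} \<in> {..<i} \<rightarrow>\<^sub>E J"
          by (intro PiE_I) auto
        with b show "restrict (h \<circ> \<pi>) {..<i} \<in> {g \<in> ?I. g ` {..<i} = G}"
          by (simp add: bij_betw_def)
      qed
      show "(\<lambda>g k. if k < i then the_inv_into {..<i} h (g k) else k) ` {g \<in> ?I. g ` {..<i} = G}
          \<subseteq> {\<pi>. \<pi> permutes {..<i}}"
      proof (rule image_subsetI)
        fix g assume "g \<in> {g \<in> ?I. g ` {..<i} = G}"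
        then have gG: "bij_betw g {..<i} G" by (simp add: bij_betw_def)
        have "bij_betw (\<lambda>k. if k < i then the_inv_into {..<i} h (g k) else k) {..<i} {..<i}"
          by (rule iffD2[OF bij_betw_cong bij_betw_trans[OF gG bij_betw_the_inv_into[OF h]]]) simp
        then show "(\<lambda>k. if k < i then the_inv_into {..<i} h (g k) else k) \<in> {\<pi>. \<pi> permutes {..<i}}"
          unfolding mem_Collect_eq by (rule bij_imp_permutes) simp
      qed
    qed
    from bij_betw_same_card[OF this] have card: "card {g \<in> ?I. g ` {..<i} = G} = fact i"
      using card_permutations[of "{..<i}" i] by simp
    have "(\<Sum>g | g \<in> ?I \<and> g ` {..<i} = G. F (g ` {..<i})) = (\<Sum>g | g \<in> ?I \<and> g ` {..<i} = G. F G)"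
      by (rule sum.cong) auto
    also have "\<dots> = of_nat (fact i) * F G" unfolding sum_constant card ..
    finally show ?thesis .
  qed
  have "(\<Sum>g\<in>?I. F (g ` {..<i})) = (\<Sum>G\<in>?S. \<Sum>g | g \<in> ?I \<and> g ` {..<i} = G. F (g ` {..<i}))"
  proof (rule sum.group[OF fin, symmetric])
    show "finite ?S" by (rule finite_subset[OF _ iffD2[OF finite_Pow_iff assms]]) auto
    show "(\<lambda>g. g ` {..<i}) ` ?I \<subseteq> ?S"
    proof (rule image_subsetI)
      fix g assume g: "g \<in> ?I"
      then have "g ` {..<i} \<subseteq> J" by blast
      moreover have "card (g ` {..<i}) = i" using g by (simp add: card_image)
      ultimately show "g ` {..<i} \<in> ?S" by simp
    qed
  qed
  also have "\<dots> = (\<Sum>G\<in>?S. of_nat (fact i) * F G)" by (rule sum.cong[OF refl fib])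
  finally show ?thesis by (simp add: sum_distrib_left)
qed

text \<open>Expand a product over \<open>K\<close> whose factors are \<open>1 + 0\<close> on
  \<open>R\<close> and \<open>1 - 1\<close> off \<open>R\<close>. A term of the expansion vanishes
  unless \<open>S\<close> contains \<open>R\<close>, and the product itself vanishes unless
  \<open>R\<close> is all of \<open>K\<close>.\<close>

lemma alternating_sum_supersets:
  assumes "finite K" "R \<subseteq> K"
  shows "(\<Sum>S\<in>Pow K. if R \<subseteq> S then (-1) ^ card (K - S) else 0)
    = (if R = K then 1 else (0::'a::comm_ring_1))"
proof -
  have "(\<Prod>s\<in>K. 1 + (if s \<in> R then 0 else - 1 :: 'a)) = (\<Sum>S\<in>Pow K. if R \<subseteq> S then (-1) ^ card (K - S) else 0)"
    unfolding prod_add[OF assms(1)]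
  proof (rule sum.cong[OF refl])
    fix S assume S: "S \<in> Pow K"
    show "(\<Prod>x\<in>S. 1) * (\<Prod>s\<in>K - S. if s \<in> R then 0 else - 1 :: 'a) = (if R \<subseteq> S then (-1) ^ card (K - S) else 0)"
    proof (cases "R \<subseteq> S")
      case True
      then have "(\<Prod>s\<in>K - S. if s \<in> R then 0 else - 1 :: 'a) = (\<Prod>s\<in>K - S. - 1)"
        by (intro prod.cong) auto
      then show ?thesis using True by simp
    next
      case False
      then obtain s where "s \<in> R" "s \<in> K - S" using assms by auto
      then have "(\<Prod>s\<in>K - S. if s \<in> R then 0 else - 1 :: 'a) = 0"
        using assms by (intro prod_zero) auto
      then show ?thesis using False by simp
    qed
  qed
  moreover have "(\<Prod>s\<in>K. 1 + (if s \<in> R then 0 else - 1 :: 'a)) = (if R = K then 1 else 0)"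
  proof (cases "R = K")
    case False
    then obtain s where "s \<in> K" "s \<notin> R" using assms by auto
    then have "(\<Prod>s\<in>K. 1 + (if s \<in> R then 0 else - 1 :: 'a)) = 0"
      using assms(1) by (intro prod_zero) auto
    then show ?thesis using False by simp
  qed simp
  ultimately show ?thesis by simp
qed

lemma sum_power_eq_PiE:
  fixes x :: "'a \<Rightarrow> 'b::comm_semiring_1"
  assumes "finite S"
  shows "(\<Sum>s\<in>S. x s) ^ k = (\<Sum>g\<in>{..<k} \<rightarrow>\<^sub>E S. \<Prod>t<k. x (g t))"
  using prod_sum_PiE[of "{..<k}" "\<lambda>_. S" "\<lambda>_. x"] assms by simp

text \<open>Expand the powers over maps \<open>g\<close> into \<open>S\<close> and exchange the
  sums. The alternating sum over \<open>S\<close> keeps only the maps with image \<open>K\<close>;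
  having a domain of size \<open>card K\<close>, these are injective, and each contributes the full
  product.\<close>

lemma polarization:
  fixes x :: "'a \<Rightarrow> 'b::comm_ring_1"
  assumes K: "finite K"
  shows "(\<Sum>S\<in>Pow K. (-1) ^ card (K - S) * (\<Sum>s\<in>S. x s) ^ card K) = of_nat (fact (card K)) * (\<Prod>s\<in>K. x s)"
proof -
  let ?k = "card K"
  have fin: "finite ({..<?k} \<rightarrow>\<^sub>E K)" using K by (intro finite_PiE) auto
  have "(\<Sum>S\<in>Pow K. (-1) ^ card (K - S) * (\<Sum>s\<in>S. x s) ^ ?k)
      = (\<Sum>S\<in>Pow K. \<Sum>g\<in>{..<?k} \<rightarrow>\<^sub>E K. (if g ` {..<?k} \<subseteq> S then (-1) ^ card (K - S) else 0) * (\<Prod>t<?k. x (g t)))"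
  proof (rule sum.cong[OF refl])
    fix S assume S: "S \<in> Pow K"
    then have "(\<Sum>s\<in>S. x s) ^ ?k = (\<Sum>g\<in>{..<?k} \<rightarrow>\<^sub>E S. \<Prod>t<?k. x (g t))"
      using K finite_subset by (intro sum_power_eq_PiE) auto
    also have "\<dots> = (\<Sum>g\<in>{..<?k} \<rightarrow>\<^sub>E K. if g ` {..<?k} \<subseteq> S then \<Prod>t<?k. x (g t) else 0)"
      using S fin by (intro sum.mono_neutral_cong_left) (auto simp: PiE_iff)
    finally show "(-1) ^ card (K - S) * (\<Sum>s\<in>S. x s) ^ ?k = (\<Sum>g\<in>{..<?k} \<rightarrow>\<^sub>E K.
        (if g ` {..<?k} \<subseteq> S then (-1) ^ card (K - S) else 0) * (\<Prod>t<?k. x (g t)))"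
      by (simp only: sum_distrib_left) (rule sum.cong, simp_all)
  qed
  also have "\<dots> = (\<Sum>g\<in>{..<?k} \<rightarrow>\<^sub>E K. (\<Sum>S\<in>Pow K. if g ` {..<?k} \<subseteq> S then (-1) ^ card (K - S) else 0) * (\<Prod>t<?k. x (g t)))"
    by (subst sum.swap) (simp add: sum_distrib_right)
  also have "\<dots> = (\<Sum>g\<in>{..<?k} \<rightarrow>\<^sub>E K. if g ` {..<?k} = K then (\<Prod>t<?k. x (g t)) else 0)"
  proof (rule sum.cong[OF refl])
    fix g assume "g \<in> {..<?k} \<rightarrow>\<^sub>E K"
    then have "g ` {..<?k} \<subseteq> K" by auto
    from alternating_sum_supersets[OF K this, where 'a='b]
    show "(\<Sum>S\<in>Pow K. if g ` {..<?k} \<subseteq> S then (-1) ^ card (K - S) else 0) * (\<Prod>t<?k. x (g t))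
       = (if g ` {..<?k} = K then (\<Prod>t<?k. x (g t)) else 0)" by simp
  qed
  also have "\<dots> = (\<Sum>g | g \<in> {..<?k} \<rightarrow>\<^sub>E K \<and> inj_on g {..<?k}. \<Prod>s\<in>g ` {..<?k}. x s)"
  proof (rule sum.mono_neutral_cong_right[OF fin])
    show "\<forall>g\<in>({..<?k} \<rightarrow>\<^sub>E K) - {g. g \<in> {..<?k} \<rightarrow>\<^sub>E K \<and> inj_on g {..<?k}}.
        (if g ` {..<?k} = K then \<Prod>t<?k. x (g t) else 0) = 0"
    proof (intro ballI)
      fix g assume "g \<in> ({..<?k} \<rightarrow>\<^sub>E K) - {g \<in> {..<?k} \<rightarrow>\<^sub>E K. inj_on g {..<?k}}"
      then have "card (g ` {..<?k}) \<noteq> ?k" using eq_card_imp_inj_on[of "{..<?k}" g] by auto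
      then show "(if g ` {..<?k} = K then \<Prod>t<?k. x (g t) else 0) = 0" by auto
    qed
    fix g assume g: "g \<in> {g. g \<in> {..<?k} \<rightarrow>\<^sub>E K \<and> inj_on g {..<?k}}"
    then have "g ` {..<?k} = K" using K by (intro card_subset_eq) (auto simp: card_image)
    then show "(if g ` {..<?k} = K then \<Prod>t<?k. x (g t) else 0) = (\<Prod>s\<in>g ` {..<?k}. x s)"
      using g prod.reindex[of g "{..<?k}" x] by simp
  qed auto
  also have "\<dots> = of_nat (fact ?k) * (\<Sum>G | G \<subseteq> K \<and> card G = ?k. \<Prod>s\<in>G. x s)"
    by (rule sum_inj_PiE[OF K])
  also have "{G. G \<subseteq> K \<and> card G = ?k} = {K}" using K card_subset_eq by auto
  finally show ?thesis by simp
qed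


subsection \<open>Moments of normal variables\<close>

text \<open>The \<open>k\<close>-th moment of the normal law with mean \<open>\<mu>\<close> and
  variance \<open>v\<close>, read off its exponential generating function. The series has the shape
  used in \<open>normal_umbral_matrix\<close>, so umbral moments are of this form by unfolding; on
  the probabilistic side this needs proof.\<close>

definition normal_moment :: "real \<Rightarrow> real \<Rightarrow> nat \<Rightarrow> real" where
  "normal_moment \<mu> v k =
     fact k * fps_nth (fps_exp 1 oo (fps_const \<mu> * fps_X + fps_const (1/2 * v) * fps_X ^ 2)) k"

text \<open>The equation \<open>F' = U F\<close> expresses the coefficient of index
  \<open>l + 1\<close> through those up to \<open>l\<close>, so the constant coefficient determines
  the series.\<close>

lemma fps_eq_of_linear_ode:
  fixes F G U :: "real fps"
  assumes "fps_deriv F = U * F" "fps_deriv G = U * G" "fps_nth F 0 = fps_nth G 0"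
  shows "F = G"
proof (rule fps_ext)
  show "fps_nth F k = fps_nth G k" for k
  proof (induction k rule: less_induct)
    case (less k)
    show ?case
    proof (cases k)
      case (Suc l)
      have "real (Suc l) * fps_nth F (Suc l) = fps_nth (U * F) l"
        using arg_cong[OF assms(1), of "\<lambda>f. fps_nth f l"] by simp
      also have "\<dots> = fps_nth (U * G) l"
        unfolding fps_mult_nth using less Suc by (intro sum.cong) auto
      also have "\<dots> = real (Suc l) * fps_nth G (Suc l)"
        using arg_cong[OF assms(2), of "\<lambda>f. fps_nth f l"] by simp
      finally show ?thesis using Suc by simp
    qed (use assms in simp)
  qed
qed

text \<open>Both sides solve \<open>F' = (a + 2 b t) F\<close> with constant coefficient
  \<open>1\<close>. The product separates the contribution of the mean from that of the centred
  law.\<close>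

lemma fps_exp_compose_quadratic:
  "fps_exp 1 oo (fps_const a * fps_X + fps_const b * fps_X ^ 2)
    = fps_exp a * (fps_exp b oo fps_X ^ 2)" for a b :: real
proof (rule fps_eq_of_linear_ode)
  let ?U = "fps_const a + fps_const (2 * b) * fps_X"
  have d2: "fps_deriv (fps_X ^ 2 :: real fps) = fps_const 2 * fps_X"
    by (simp add: fps_deriv_power numeral_fps_const)
  show "fps_deriv (fps_exp 1 oo (fps_const a * fps_X + fps_const b * fps_X ^ 2))
     = ?U * (fps_exp 1 oo (fps_const a * fps_X + fps_const b * fps_X ^ 2))"
    by (simp add: fps_compose_deriv d2 mult_ac flip: fps_const_mult)
  show "fps_deriv (fps_exp a * (fps_exp b oo fps_X ^ 2)) = ?U * (fps_exp a * (fps_exp b oo fps_X ^ 2))"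
    by (simp add: fps_compose_deriv d2 fps_compose_mult_distrib algebra_simps flip: fps_const_mult)
qed (simp add: fps_compose_nth)

lemma fps_nth_compose_square:
  fixes f :: "real fps"
  shows "fps_nth (f oo fps_X ^ 2) k = (if even k then fps_nth f (k div 2) else 0)"
proof -
  have "fps_nth (f oo fps_X ^ 2) k = (\<Sum>i=0..k. if k = 2 * i then fps_nth f i else 0)"
    unfolding fps_compose_nth power_mult[symmetric]
    by (simp only: fps_X_power_nth mult_if_delta) (intro sum.cong, auto)
  also have "\<dots> = (\<Sum>i\<in>{0..k}. if i = k div 2 \<and> even k then fps_nth f i else 0)"
    by (intro sum.cong) auto
  finally show ?thesis by (cases "even k") auto
qed

text \<open>The Cauchy product of the two exponential factors. The conditional term is the central
  moment of order \<open>k - j\<close>, so this is the binomial expansion of a moment around the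
  mean.\<close>

lemma normal_moment_binomial:
  "normal_moment \<mu> v k = (\<Sum>j\<le>k. real (k choose j) * \<mu> ^ j *
     (if even (k - j) then fact (k - j) * (v / 2) ^ ((k - j) div 2) / fact ((k - j) div 2) else 0))"
  unfolding normal_moment_def fps_exp_compose_quadratic fps_mult_nth fps_nth_compose_square sum_distrib_left
  by (intro sum.cong) (auto simp: binomial_fact field_simps atMost_atLeast0)

lemma normal_moment_0 [simp]: "normal_moment \<mu> v 0 = 1"
  and normal_moment_1 [simp]: "normal_moment \<mu> v (Suc 0) = \<mu>"
  and normal_moment_2 [simp]: "normal_moment \<mu> v 2 = \<mu>\<^sup>2 + v"
  by (simp_all add: normal_moment_binomial numeral_2_eq_2 algebra_simps)

text \<open>Write \<open>x\<close> as \<open>\<mu> + (x - \<mu>)\<close> and integrate the binomial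
  expansion against the known central moments.\<close>

lemma has_bochner_integral_normal_power:
  assumes v: "0 < v"
  shows "has_bochner_integral lborel (\<lambda>x. normal_density \<mu> (sqrt v) x * x ^ k) (normal_moment \<mu> v k)"
proof -
  have c: "has_bochner_integral lborel (\<lambda>x. normal_density \<mu> (sqrt v) x * (x - \<mu>) ^ l)
     (if even l then fact l * (v / 2) ^ (l div 2) / fact (l div 2) else 0)" for l
  proof (cases "even l")
    case True
    then obtain r where "l = 2 * r" by (elim evenE)
    then show ?thesis using normal_moment_even[of "sqrt v" \<mu> r] v
      by (simp add: field_simps)
  next
    case False
    then obtain r where "l = 2 * r + 1" by (elim oddE)
    then show ?thesis using normal_moment_odd[of "sqrt v" \<mu> r] v by simp
  qed
  have "x ^ k = (\<Sum>j\<le>k. real (k choose j) * \<mu> ^ j * (x - \<mu>) ^ (k - j))" for x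
    using binomial_ring[of \<mu> "x - \<mu>" k] by simp
  then have "(\<lambda>x. normal_density \<mu> (sqrt v) x * x ^ k) = (\<lambda>x. \<Sum>j\<le>k. real (k choose j) * \<mu> ^ j *
      (normal_density \<mu> (sqrt v) x * (x - \<mu>) ^ (k - j)))"
    by (simp add: sum_distrib_left mult_ac)
  then show ?thesis
    unfolding normal_moment_binomial
    by (simp only:) (intro has_bochner_integral_sum has_bochner_integral_mult_right c)
qed

text \<open>Point masses must be covered too: the linear form with all coefficients \<open>0\<close>
  has variance \<open>0\<close>, and polarization involves it through the empty subset.\<close>

lemma (in prob_space) normal_rv_moment:
  assumes "normal_rv M Y \<mu> v"
  shows "has_bochner_integral M (\<lambda>\<omega>. Y \<omega> ^ k) (normal_moment \<mu> v k)"
proof -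
  have Y [measurable]: "Y \<in> borel_measurable M" and v: "0 \<le> v"
    and d: "distr M borel Y = (if v = 0 then return borel \<mu> else density lborel (normal_density \<mu> (sqrt v)))"
    using assms by (auto simp: normal_rv_def)
  have "has_bochner_integral (distr M borel Y) (\<lambda>x. x ^ k) (normal_moment \<mu> v k)"
  proof (cases "v = 0")
    case True
    \<comment> \<open>For variance \<open>0\<close> every central moment of positive order vanishes,
      which leaves the term \<open>j = k\<close>.\<close>
    have "(\<Sum>j\<le>k. real (k choose j) * \<mu> ^ j *
        (if even (k - j) then fact (k - j) * (0 / 2) ^ ((k - j) div 2) / fact ((k - j) div 2) else 0))
      = (\<Sum>j\<le>k. if j = k then \<mu> ^ k else (0::real))"
    proof (rule sum.cong[OF refl])
      fix j assume "j \<in> {..k}"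
      then have jk: "j = k \<or> k - j \<noteq> 0" by auto
      have "(if even l then fact l * (0 / 2) ^ (l div 2) / fact (l div 2) else 0) = (if l = 0 then 1 else (0::real))" for l :: nat
        by (cases "l div 2 = 0") auto
      from this[of "k - j"] show "real (k choose j) * \<mu> ^ j *
          (if even (k - j) then fact (k - j) * (0 / 2) ^ ((k - j) div 2) / fact ((k - j) div 2) else 0)
        = (if j = k then \<mu> ^ k else 0)" using jk by auto
    qed
    then have "normal_moment \<mu> 0 k = \<mu> ^ k"
      unfolding normal_moment_binomial by simp
    moreover have "has_bochner_integral (distr M borel (\<lambda>_. \<mu>)) (\<lambda>x. x ^ k) (\<mu> ^ k)"
      by (intro has_bochner_integral_distr) (simp_all add: has_bochner_integral_iff prob_space)
    ultimately show ?thesis using True d by simp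
  next
    case False
    then show ?thesis using d v has_bochner_integral_normal_power[of v \<mu> k]
      by (simp add: has_bochner_integral_density)
  qed
  then show ?thesis
    by (simp add: has_bochner_integral_iff integrable_distr_eq integral_distr)
qed


subsection \<open>Joint moments of independent normal variables\<close>

text \<open>The joint moment of the variables \<open>c t\<close>, \<open>t \<in> K\<close>, as polarization expresses it through the
  moments of the linear forms \<open>\<Sum>t\<in>S. c t\<close>, in which the variable \<open>j\<close> has the number of \<open>t \<in> S\<close> with
  \<open>c t = j\<close> as its coefficient.\<close>

definition polarized_moment :: "'j set \<Rightarrow> 't set \<Rightarrow> ('t \<Rightarrow> 'j) \<Rightarrow> ('j \<Rightarrow> real) \<Rightarrow> real \<Rightarrow> real" where
  "polarized_moment J K c d v = (\<Sum>S\<in>Pow K. (-1) ^ card (K - S) *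
      normal_moment (\<Sum>j\<in>J. real (card {t \<in> S. c t = j}) * d j)
        (v * (\<Sum>j\<in>J. (real (card {t \<in> S. c t = j}))\<^sup>2)) (card K)) / fact (card K)"

text \<open>Rewrites a sum over possibly repeated variables as a linear form in the distinct ones.
  It is stated over a semiring to serve real-valued and umbral families alike.\<close>

lemma sum_eq_sum_card_fibres:
  fixes x :: "'j \<Rightarrow> 'b::semiring_1"
  assumes "finite S" "finite J" "c ` S \<subseteq> J"
  shows "(\<Sum>t\<in>S. x (c t)) = (\<Sum>j\<in>J. of_nat (card {t \<in> S. c t = j}) * x j)"
proof -
  have "(\<Sum>t\<in>S. x (c t)) = (\<Sum>j\<in>J. \<Sum>t | t \<in> S \<and> c t = j. x (c t))"
    by (rule sum.group[OF assms, symmetric])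
  also have "\<dots> = (\<Sum>j\<in>J. of_nat (card {t \<in> S. c t = j}) * x j)"
    by (intro sum.cong refl) simp
  finally show ?thesis .
qed

text \<open>Polarization writes the product as a combination of powers of subset sums. Each subset
  sum is a linear form in the \<open>N j\<close>, so \<open>normal\<close> yields both the
  integrability and the value of its powers.\<close>

lemma (in prob_space) has_bochner_integral_prod_gaussian:
  fixes N :: "'j \<Rightarrow> 'a \<Rightarrow> real"
  assumes normal: "\<And>z. normal_rv M (\<lambda>\<omega>. \<Sum>j\<in>J. z j * N j \<omega>) (\<Sum>j\<in>J. z j * d j) (v * (\<Sum>j\<in>J. (z j)\<^sup>2))"
    and J: "finite J" and K: "finite K" "c ` K \<subseteq> J"
  shows "has_bochner_integral M (\<lambda>\<omega>. \<Prod>t\<in>K. N (c t) \<omega>) (polarized_moment J K c d v)"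
proof -
  have *: "has_bochner_integral M (\<lambda>\<omega>. (\<Sum>t\<in>S. N (c t) \<omega>) ^ k)
     (normal_moment (\<Sum>j\<in>J. real (card {t \<in> S. c t = j}) * d j)
        (v * (\<Sum>j\<in>J. (real (card {t \<in> S. c t = j}))\<^sup>2)) k)" if "S \<in> Pow K" for S k
  proof -
    have "finite S" "c ` S \<subseteq> J" using that K finite_subset by auto
    from sum_eq_sum_card_fibres[OF this(1) J this(2)]
    have "(\<Sum>t\<in>S. N (c t) \<omega>) = (\<Sum>j\<in>J. real (card {t \<in> S. c t = j}) * N j \<omega>)" for \<omega> .
    then show ?thesis using normal_rv_moment[OF normal, of "\<lambda>j. real (card {t \<in> S. c t = j})" k] by simp
  qed
  have "(\<Prod>t\<in>K. N (c t) \<omega>) = (\<Sum>S\<in>Pow K. (-1) ^ card (K - S) * (\<Sum>t\<in>S. N (c t) \<omega>) ^ card K) / fact (card K)" for \<omega>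
    using polarization[OF K(1), of "\<lambda>t. N (c t) \<omega>"] by simp
  then show ?thesis
    unfolding polarized_moment_def
    by (simp only:) (intro has_bochner_integral_divide_zero has_bochner_integral_sum
        has_bochner_integral_mult_right *)
qed

section \<open>Sums of independent normal variables and the product formula for joint
  moments\<close>

text \<open>\<open>sum_indep_normal\<close> asks for a nonempty family with positive standard
  deviations. Summands of variance \<open>0\<close> are assumed to vanish on the whole space, with
  mean \<open>0\<close>, so they are discarded first; if none remains, the sum is a point mass at
  \<open>0\<close>.\<close>

lemma (in prob_space) normal_rv_sum_indep:
  assumes J: "finite J" and indep: "indep_vars (\<lambda>_. borel) Y J"
    and normal: "\<And>j. j \<in> J \<Longrightarrow> normal_rv M (Y j) (\<mu> j) (v j)"
    and zero: "\<And>j \<omega>. j \<in> J \<Longrightarrow> v j = 0 \<Longrightarrow> \<omega> \<in> space M \<Longrightarrow> Y j \<omega> = 0"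
    and zero_mean: "\<And>j. j \<in> J \<Longrightarrow> v j = 0 \<Longrightarrow> \<mu> j = 0"
  shows "normal_rv M (\<lambda>\<omega>. \<Sum>j\<in>J. Y j \<omega>) (\<Sum>j\<in>J. \<mu> j) (\<Sum>j\<in>J. v j)"
proof -
  let ?J = "{j \<in> J. v j \<noteq> 0}"
  have Y: "Y j \<in> borel_measurable M" and v: "0 \<le> v j" if "j \<in> J" for j
    using normal[OF that] by (auto simp: normal_rv_def)
  have meas: "(\<lambda>\<omega>. \<Sum>j\<in>J. Y j \<omega>) \<in> borel_measurable M" using Y by measurable
  have sums: "(\<Sum>j\<in>J. \<mu> j) = (\<Sum>j\<in>?J. \<mu> j)" "(\<Sum>j\<in>J. v j) = (\<Sum>j\<in>?J. v j)"
    "\<And>\<omega>. \<omega> \<in> space M \<Longrightarrow> (\<Sum>j\<in>J. Y j \<omega>) = (\<Sum>j\<in>?J. Y j \<omega>)"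
    using J zero zero_mean by (auto intro!: sum.mono_neutral_right)
  have distr: "distr M borel (\<lambda>\<omega>. \<Sum>j\<in>J. Y j \<omega>) = distr M borel (\<lambda>\<omega>. \<Sum>j\<in>?J. Y j \<omega>)"
    by (rule distr_cong) (simp_all add: sums)
  show ?thesis
  proof (cases "?J = {}")
    case True
    have "distr M borel (\<lambda>\<omega>. 0) = return borel (0::real)"
      by (rule distr_const) simp
    then show ?thesis unfolding normal_rv_def distr using meas by (simp add: sums True)
  next
    case False
    have vpos: "0 < v j" if "j \<in> ?J" for j using v[of j] that by auto
    have sum_pos: "0 < (\<Sum>j\<in>?J. v j)" using J False vpos by (intro sum_pos) auto
    have "distributed M lborel (\<lambda>\<omega>. \<Sum>j\<in>?J. Y j \<omega>)
        (normal_density (\<Sum>j\<in>?J. \<mu> j) (sqrt (\<Sum>j\<in>?J. (sqrt (v j))\<^sup>2)))"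
    proof (rule sum_indep_normal)
      fix j assume j: "j \<in> ?J"
      then have "distr M lborel (Y j) = density lborel (normal_density (\<mu> j) (sqrt (v j)))"
        using normal[of j] by (simp add: normal_rv_def cong: distr_cong)
      then show "distributed M lborel (Y j) (normal_density (\<mu> j) (sqrt (v j)))"
        using Y j by (simp add: distributed_def)
      show "0 < sqrt (v j)" using vpos[OF j] by simp
    qed (use J False indep_vars_subset[OF indep] in auto)
    then have "distr M lborel (\<lambda>\<omega>. \<Sum>j\<in>?J. Y j \<omega>)
        = density lborel (normal_density (\<Sum>j\<in>?J. \<mu> j) (sqrt (\<Sum>j\<in>?J. v j)))"
      using v by (simp add: distributed_def)
    then show ?thesis unfolding normal_rv_def distr using meas sum_pos
      by (simp add: sums cong: distr_cong)
  qed
qed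

text \<open>The moment is computed in the product measure, one family with the required linear forms.\<close>

lemma polarized_moment_eq_prod:
  assumes v: "0 < v" and J: "finite J" and K: "finite K" "c ` K \<subseteq> J"
  shows "polarized_moment J K c d v = (\<Prod>j\<in>J. normal_moment (d j) v (card {t \<in> K. c t = j}))"
proof -
  \<comment> \<open>Under the product of these laws the coordinates are independent normal variables
    with means \<open>d j\<close> and variance \<open>v\<close>. The mixed moment of the coordinates
    is computed twice, by polarization and by Fubini.\<close>
  define D where "D j = density lborel (normal_density (d j) (sqrt v))" for j
  have D: "prob_space (D j)" for j
    unfolding D_def using v by (intro prob_space_normal_density) simp
  let ?P = "Pi\<^sub>M J D"
  interpret P: prob_space ?P by (rule prob_space_PiM[OF D])
  interpret D: product_prob_space D J
    by (intro product_prob_spaceI D)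
  have sets_D [simp, measurable_cong]: "sets (D j) = sets borel" for j by (simp add: D_def)
  have indep: "P.indep_vars (\<lambda>_. borel) (\<lambda>j \<omega>. z j * \<omega> j) J" for z :: "_ \<Rightarrow> real"
  proof -
    have "P.indep_vars D (\<lambda>j \<omega>. \<omega> j) J"
    \<comment> \<open>The criterion through joint laws needs a nonempty index set; over the empty
      one independence is trivial.\<close>
    proof (cases "J = {}")
      case True
      then show ?thesis unfolding P.indep_vars_def P.indep_sets_def by simp
    next
      case False
      have "distr ?P ?P (\<lambda>\<omega>. \<lambda>j\<in>J. \<omega> j) = distr ?P ?P (\<lambda>\<omega>. \<omega>)"
        by (rule distr_cong) (auto simp: space_PiM)
      also have "\<dots> = Pi\<^sub>M J (\<lambda>j. distr ?P (D j) (\<lambda>\<omega>. \<omega> j))"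
        using D by (simp add: distr_PiM_component cong: PiM_cong)
      finally show ?thesis using False by (subst P.indep_vars_iff_distr_eq_PiM') auto
    qed
    from P.indep_vars_compose2[OF this, of "\<lambda>j x. z j * x" "\<lambda>_. borel"] show ?thesis
      by simp
  qed
  have coord: "distributed ?P lborel (\<lambda>\<omega>. \<omega> j) (normal_density (d j) (sqrt v))" if "j \<in> J" for j
  proof -
    have "distr ?P lborel (\<lambda>\<omega>. \<omega> j) = distr ?P (D j) (\<lambda>\<omega>. \<omega> j)"
      by (rule distr_cong) auto
    also have "\<dots> = D j" using D that by (intro distr_PiM_component)
    finally show ?thesis using that by (simp add: distributed_def D_def)
  qed
  have scaled: "normal_rv ?P (\<lambda>\<omega>. z j * \<omega> j) (z j * d j) (v * (z j)\<^sup>2)" if "j \<in> J" for z j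
  \<comment> \<open>An affine image of a normal variable has a normal density only for a nonzero
    factor; a zero coefficient gives the point mass at \<open>0\<close>.\<close>
  proof (cases "z j = 0")
    case True
    have "distr ?P borel (\<lambda>\<omega>. 0) = return borel (0::real)" by (rule P.distr_const) simp
    then show ?thesis using True by (simp add: normal_rv_def)
  next
    case False
    then have "distributed ?P lborel (\<lambda>\<omega>. 0 + z j * \<omega> j) (normal_density (0 + z j * d j) (\<bar>z j\<bar> * sqrt v))"
      using v by (intro P.normal_density_affine coord that) auto
    moreover have "\<bar>z j\<bar> * sqrt v = sqrt (v * (z j)\<^sup>2)" by (simp add: real_sqrt_mult)
    ultimately show ?thesis using v False that
      by (simp add: distributed_def normal_rv_def cong: distr_cong)
  qed
  have "normal_rv ?P (\<lambda>\<omega>. \<Sum>j\<in>J. z j * \<omega> j) (\<Sum>j\<in>J. z j * d j) (v * (\<Sum>j\<in>J. (z j)\<^sup>2))" for z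
    unfolding sum_distrib_left
    by (rule P.normal_rv_sum_indep) (use J indep scaled v in auto)
  from P.has_bochner_integral_prod_gaussian[OF this J K]
  have "polarized_moment J K c d v = (\<integral>\<omega>. (\<Prod>t\<in>K. \<omega> (c t)) \<partial>?P)"
    by (simp add: has_bochner_integral_iff)
  \<comment> \<open>Second evaluation: grouping equal variables yields a product of functions of
    separate coordinates, and the integral over the product measure then factors.\<close>
  also have "\<dots> = (\<integral>\<omega>. (\<Prod>j\<in>J. \<omega> j ^ card {t \<in> K. c t = j}) \<partial>?P)"
  proof -
    have "(\<Prod>t\<in>K. \<omega> (c t)) = (\<Prod>j\<in>J. \<omega> j ^ card {t \<in> K. c t = j})" for \<omega> :: "_ \<Rightarrow> real"
    proof -
      have "(\<Prod>t\<in>K. \<omega> (c t)) = (\<Prod>j\<in>J. \<Prod>t | t \<in> K \<and> c t = j. \<omega> (c t))"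
        by (rule prod.group[OF K(1) J K(2), symmetric])
      then show ?thesis by simp
    qed
    then show ?thesis by simp
  qed
  also have "\<dots> = (\<Prod>j\<in>J. normal_moment (d j) v (card {t \<in> K. c t = j}))"
  proof -
    have "has_bochner_integral (D j) (\<lambda>x. x ^ k) (normal_moment (d j) v k)" for j k
      unfolding D_def using has_bochner_integral_normal_power[OF v]
      by (intro has_bochner_integral_density) auto
    then show ?thesis
      by (subst D.product_integral_prod[OF J]) (auto simp: has_bochner_integral_iff)
  qed
  finally show ?thesis .
qed


subsection \<open>Umbral evaluation\<close>

lemma uconst_add: "uconst (a + b) = uconst a + uconst b"
  and uconst_mult: "uconst (a * b) = uconst a * uconst b"
  and uconst_0: "uconst 0 = 0"
  and uconst_1: "uconst 1 = 1"
  by (simp_all add: uconst_def single_add mult_single single_one)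

lemma uconst_of_nat: "uconst (of_nat k) = of_nat k"
  by (induction k) (simp_all add: uconst_0 uconst_1 uconst_add)

lemma uconst_power_minus_1: "uconst ((-1) ^ k) = (-1) ^ k"
proof -
  have m: "uconst (-1) = - 1" by (simp add: uconst_def single_uminus single_one)
  show ?thesis by (induction k) (simp_all only: power_0 power_Suc uconst_1 uconst_mult m)
qed

lemma umbral_poly_decompose:
  fixes x :: "'u umbral_poly"
  shows "x = (\<Sum>m\<in>Poly_Mapping.keys x. uconst (Poly_Mapping.lookup x m) * Poly_Mapping.single m 1)"
proof -
  have "uconst c * Poly_Mapping.single m 1 = Poly_Mapping.single m c" for c and m :: "'u \<Rightarrow>\<^sub>0 nat"
    by (simp add: uconst_def mult_single)
  moreover have "x = (\<Sum>m\<in>Poly_Mapping.keys x. Poly_Mapping.single m (Poly_Mapping.lookup x m))"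
    by (rule poly_mapping_eqI) (auto simp: lookup_sum lookup_single when_def in_keys_iff)
  ultimately show ?thesis by simp
qed

context
  fixes E :: "'u umbral_poly \<Rightarrow> real"
  assumes E: "umbral_evaluation E"
begin

lemma eval_add: "E (x + y) = E x + E y"
  and eval_uconst_mult: "E (uconst c * x) = c * E x"
  and eval_1: "E 1 = 1"
  and eval_single: "E (Poly_Mapping.single m 1) =
        (\<Prod>u\<in>Poly_Mapping.keys m. E (umbra u ^ Poly_Mapping.lookup m u))"
  using E unfolding umbral_evaluation_def by blast+

lemma eval_0: "E 0 = 0"
  using eval_uconst_mult[of 0 0] by simp

lemma eval_sum: "E (\<Sum>j\<in>J. f j) = (\<Sum>j\<in>J. E (f j))"
  by (induction J rule: infinite_finite_induct) (simp_all add: eval_0 eval_add)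

text \<open>By bilinearity it suffices to treat monomials. When their supports are disjoint, the
  product of two monomials keeps each exponent unchanged, so the product in
  \<open>eval_single\<close> splits along the two supports.\<close>

lemma eval_mult_disjoint:
  assumes "umbrae_of x \<inter> umbrae_of y = {}"
  shows "E (x * y) = E x * E y"
proof -
  have single: "E (Poly_Mapping.single m 1 * Poly_Mapping.single m' 1)
      = E (Poly_Mapping.single m 1) * E (Poly_Mapping.single m' 1)"
    if "m \<in> Poly_Mapping.keys x" "m' \<in> Poly_Mapping.keys y" for m m'
  proof -
    have disj: "Poly_Mapping.keys m \<inter> Poly_Mapping.keys m' = {}"
      using assms that unfolding umbrae_of_def by blast
    then have k0: "Poly_Mapping.lookup m' u = 0" if "u \<in> Poly_Mapping.keys m" for u
      using that by (auto simp: in_keys_iff)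
    have k0': "Poly_Mapping.lookup m u = 0" if "u \<in> Poly_Mapping.keys m'" for u
      using that disj by (auto simp: in_keys_iff)
    have keys: "Poly_Mapping.keys (m + m') = Poly_Mapping.keys m \<union> Poly_Mapping.keys m'"
      by (auto simp: in_keys_iff lookup_add)
    have "E (Poly_Mapping.single m 1 * Poly_Mapping.single m' 1) = E (Poly_Mapping.single (m + m') 1)"
      by (simp add: mult_single)
    also have "\<dots> = (\<Prod>u\<in>Poly_Mapping.keys m \<union> Poly_Mapping.keys m'. E (umbra u ^ Poly_Mapping.lookup (m + m') u))"
      unfolding eval_single keys ..
    also have "\<dots> = E (Poly_Mapping.single m 1) * E (Poly_Mapping.single m' 1)"
      unfolding eval_single
      by (subst prod.union_disjoint) (auto simp: disj lookup_add k0 k0' intro!: arg_cong2[where f = "(*)"] prod.cong)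
    finally show ?thesis .
  qed
  let ?s = "\<lambda>m::'u \<Rightarrow>\<^sub>0 nat. Poly_Mapping.single m (1::real)"
  have "x * y = (\<Sum>m\<in>Poly_Mapping.keys x. \<Sum>m'\<in>Poly_Mapping.keys y.
      uconst (Poly_Mapping.lookup x m) * (uconst (Poly_Mapping.lookup y m') * (?s m * ?s m')))"
    by (subst (1) umbral_poly_decompose[of x], subst (1) umbral_poly_decompose[of y])
      (simp add: sum_product mult_ac)
  then have "E (x * y) = (\<Sum>m\<in>Poly_Mapping.keys x. \<Sum>m'\<in>Poly_Mapping.keys y.
      Poly_Mapping.lookup x m * (Poly_Mapping.lookup y m' * (E (?s m) * E (?s m'))))"
    by (simp add: eval_sum eval_uconst_mult single)
  also have "\<dots> = (\<Sum>m\<in>Poly_Mapping.keys x. Poly_Mapping.lookup x m * E (?s m)) *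
      (\<Sum>m\<in>Poly_Mapping.keys y. Poly_Mapping.lookup y m * E (?s m))"
    by (simp add: sum_product mult_ac)
  also have "\<dots> = E x * E y"
    by (subst (3) umbral_poly_decompose[of x], subst (3) umbral_poly_decompose[of y])
      (simp add: eval_sum eval_uconst_mult)
  finally show ?thesis .
qed

lemma eval_delta_power:
  assumes "delta_umbra E u"
  shows "E (umbra u ^ k) = (if k = 0 \<or> k = 2 then 1 else 0)"
proof -
  have "fps_nth (umbral_gf E (umbra u)) k = fps_nth (1 + fps_const (1/2) * fps_X ^ 2) k"
    using assms by (simp add: delta_umbra_def)
  then have "E (umbra u ^ k) / fact k = (if k = 0 then 1 else if k = 2 then 1 / 2 else 0)"
    by (auto simp: umbral_gf_def)
  then show ?thesis by (auto simp: field_simps split: if_splits)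
qed

end

section \<open>Umbrae occurring in sums, products and powers\<close>

lemma umbrae_of_add: "umbrae_of (x + y) \<subseteq> umbrae_of x \<union> umbrae_of y"
  unfolding umbrae_of_def using Poly_Mapping.keys_add[of x y] by blast

lemma umbrae_of_mult: "umbrae_of (x * y) \<subseteq> umbrae_of x \<union> umbrae_of y"
proof
  fix u assume "u \<in> umbrae_of (x * y)"
  then obtain m where m: "m \<in> Poly_Mapping.keys (x * y)" "u \<in> Poly_Mapping.keys m"
    by (auto simp: umbrae_of_def)
  then obtain a b where "m = a + b" "a \<in> Poly_Mapping.keys x" "b \<in> Poly_Mapping.keys y"
    using keys_mult[of x y] by blast
  then show "u \<in> umbrae_of x \<union> umbrae_of y"
    using m Poly_Mapping.keys_add[of a b] by (auto simp: umbrae_of_def)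
qed

lemma umbrae_of_uconst: "umbrae_of (uconst c) = {}"
  by (auto simp: umbrae_of_def uconst_def)

lemma umbrae_of_1: "umbrae_of 1 = {}"
  using umbrae_of_uconst[of 1] by (simp add: uconst_1)

lemma umbrae_of_umbra: "umbrae_of (umbra u) = {u}"
  by (simp add: umbrae_of_def umbra_def)

lemma umbrae_of_sum: "umbrae_of (\<Sum>j\<in>J. f j) \<subseteq> (\<Union>j\<in>J. umbrae_of (f j))"
proof (induction J rule: infinite_finite_induct)
  case (insert j J)
  then show ?case using umbrae_of_add[of "f j" "\<Sum>j\<in>J. f j"] by auto
qed (simp_all add: umbrae_of_def)

lemma umbrae_of_prod: "umbrae_of (\<Prod>j\<in>J. f j) \<subseteq> (\<Union>j\<in>J. umbrae_of (f j))"
proof (induction J rule: infinite_finite_induct)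
  case (insert j J)
  then show ?case using umbrae_of_mult[of "f j" "\<Prod>j\<in>J. f j"] by auto
qed (simp_all add: umbrae_of_1)

lemma umbrae_of_power: "umbrae_of (x ^ k) \<subseteq> umbrae_of x"
proof (induction k)
  case (Suc k)
  then show ?case using umbrae_of_mult[of x "x ^ k"] by auto
qed (simp add: umbrae_of_1)

section \<open>Evaluation of delta products and of Gaussian products\<close>

lemma eval_prod_umbra_power:
  assumes E: "umbral_evaluation E" and "finite U"
  shows "E (\<Prod>u\<in>U. umbra u ^ a u) = (\<Prod>u\<in>U. E (umbra u ^ a u))"
  using \<open>finite U\<close>
proof (induction U rule: finite_induct)
  case (insert u U)
  have "umbrae_of (\<Prod>u\<in>U. umbra u ^ a u) \<subseteq> U"
    using umbrae_of_prod[of "\<lambda>u. umbra u ^ a u" U] umbrae_of_power by (fastforce simp: umbrae_of_umbra)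
  moreover have "umbrae_of (umbra u ^ a u) \<subseteq> {u}"
    using umbrae_of_power[of "umbra u"] by (simp add: umbrae_of_umbra)
  ultimately have "umbrae_of (umbra u ^ a u) \<inter> umbrae_of (\<Prod>u\<in>U. umbra u ^ a u) = {}"
    using insert by auto
  from eval_mult_disjoint[OF E this] show ?case using insert by simp
qed (simp add: eval_1[OF E])

text \<open>After equal umbrae are collected, an umbra occurring \<open>r\<close> times carries the
  exponent \<open>2 * r\<close>, with \<open>r\<close> positive. A delta umbra evaluates this to
  \<open>1\<close> for \<open>r = 1\<close> and to \<open>0\<close> beyond, so any repetition
  annihilates the product.\<close>

lemma eval_prod_delta_squares:
  assumes E: "umbral_evaluation E" and S: "finite S"
    and delta: "\<And>s. s \<in> S \<Longrightarrow> delta_umbra E (w s)"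
  shows "E (\<Prod>s\<in>S. (umbra (w s))\<^sup>2) = (if inj_on w S then 1 else 0)"
proof -
  have "(\<Prod>s\<in>S. (umbra (w s))\<^sup>2) = (\<Prod>u\<in>w ` S. \<Prod>s | s \<in> S \<and> w s = u. (umbra (w s))\<^sup>2)"
    by (rule prod.group[symmetric]) (use S in auto)
  also have "\<dots> = (\<Prod>u\<in>w ` S. umbra u ^ (2 * card {s \<in> S. w s = u}))"
    by (intro prod.cong refl) (simp add: power_mult)
  finally have "E (\<Prod>s\<in>S. (umbra (w s))\<^sup>2) = (\<Prod>u\<in>w ` S. E (umbra u ^ (2 * card {s \<in> S. w s = u})))"
    using eval_prod_umbra_power[OF E, of "w ` S"] S by simp
  also have "\<dots> = (\<Prod>u\<in>w ` S. if card {s \<in> S. w s = u} = 1 then 1 else 0)"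
  proof (rule prod.cong[OF refl])
    fix u assume "u \<in> w ` S"
    then obtain s where s: "s \<in> S" "u = w s" by auto
    then have "card {s \<in> S. w s = u} \<noteq> 0" using S by auto
    then show "E (umbra u ^ (2 * card {s \<in> S. w s = u})) = (if card {s \<in> S. w s = u} = 1 then 1 else 0)"
      using eval_delta_power[OF E delta[OF s(1)], of "2 * card {s \<in> S. w s = u}"] s(2) by auto
  qed
  also have "\<dots> = (if inj_on w S then 1 else 0)"
  proof (cases "inj_on w S")
    case True
    have "card {s \<in> S. w s = u} = 1" if u: "u \<in> w ` S" for u
    proof -
      obtain s where "s \<in> S" "u = w s" using u by auto
      then have "{s \<in> S. w s = u} = {s}" using True by (auto dest: inj_onD)
      then show ?thesis by simp
    qed
    then show ?thesis using True by simp
  next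
    case False
    then obtain s t where st: "s \<in> S" "t \<in> S" "s \<noteq> t" "w s = w t" by (auto simp: inj_on_def)
    have "card {s, t} \<le> card {r \<in> S. w r = w s}" using st S by (intro card_mono) auto
    then have "card {r \<in> S. w r = w s} \<noteq> 1" using st by auto
    then show ?thesis using False st S by (auto intro!: prod_zero)
  qed
  finally show ?thesis .
qed

text \<open>The umbral counterpart of \<open>has_bochner_integral_prod_gaussian\<close>. Since both
  produce the same \<open>polarized_moment\<close>, the random and the umbral entries have equal
  joint moments.\<close>

lemma eval_prod_gaussian:
  fixes N :: "'j \<Rightarrow> 'u umbral_poly"
  assumes E: "umbral_evaluation E"
    and moments: "\<And>z k. E ((\<Sum>j\<in>J. uconst (z j) * N j) ^ k)
       = normal_moment (\<Sum>j\<in>J. z j * d j) (v * (\<Sum>j\<in>J. (z j)\<^sup>2)) k"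
    and J: "finite J" and K: "finite K" "c ` K \<subseteq> J"
  shows "E (\<Prod>t\<in>K. N (c t)) = polarized_moment J K c d v"
proof -
  have *: "E ((\<Sum>t\<in>S. N (c t)) ^ k) = normal_moment (\<Sum>j\<in>J. real (card {t \<in> S. c t = j}) * d j)
        (v * (\<Sum>j\<in>J. (real (card {t \<in> S. c t = j}))\<^sup>2)) k" if "S \<in> Pow K" for S k
  proof -
    have "finite S" "c ` S \<subseteq> J" using that K finite_subset by auto
    from sum_eq_sum_card_fibres[OF this(1) J this(2), of N]
    have "(\<Sum>t\<in>S. N (c t)) = (\<Sum>j\<in>J. uconst (real (card {t \<in> S. c t = j})) * N j)"
      by (simp add: uconst_of_nat)
    then show ?thesis by (simp only: moments)
  qed
  \<comment> \<open>Polarization is applied without division: the factorial and the signs pass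
    through \<open>uconst\<close>, and the factorial is cancelled only after evaluation, among the
    reals.\<close>
  have "fact (card K) * E (\<Prod>t\<in>K. N (c t)) = E (uconst (of_nat (fact (card K))) * (\<Prod>t\<in>K. N (c t)))"
    by (simp add: eval_uconst_mult[OF E])
  also have "\<dots> = E (of_nat (fact (card K)) * (\<Prod>t\<in>K. N (c t)))"
    unfolding uconst_of_nat ..
  also have "\<dots> = E (\<Sum>S\<in>Pow K. uconst ((-1) ^ card (K - S)) * (\<Sum>t\<in>S. N (c t)) ^ card K)"
    unfolding uconst_power_minus_1 polarization[OF K(1)] ..
  also have "\<dots> = (\<Sum>S\<in>Pow K. (-1) ^ card (K - S) * E ((\<Sum>t\<in>S. N (c t)) ^ card K))"
    by (simp only: eval_sum[OF E] eval_uconst_mult[OF E])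
  also have "\<dots> = fact (card K) * polarized_moment J K c d v"
    unfolding polarized_moment_def by (simp add: *)
  finally show ?thesis by simp
qed


subsection \<open>Principal minors and latent roots\<close>

text \<open>Each factor contributes its constant or its linear term; degree
  \<open>card K - i\<close> arises exactly when the constant term is taken on an
  \<open>i\<close>-element set.\<close>

lemma coeff_prod_linear:
  fixes a b :: "'a \<Rightarrow> 'b::comm_ring_1"
  assumes "finite K" "i \<le> card K"
  shows "coeff (\<Prod>k\<in>K. [:a k, b k:]) (card K - i)
    = (\<Sum>I | I \<subseteq> K \<and> card I = i. (\<Prod>k\<in>I. a k) * (\<Prod>k\<in>K - I. b k))"
proof -
  have linear: "[:0, b k:] = monom (b k) 1" for k by (simp add: monom_Suc monom_0)
  have monom: "(\<Prod>k\<in>I. [:0, b k:]) = monom (\<Prod>k\<in>I. b k) (card I)" if "finite I" for I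
    unfolding linear using that by (induction I rule: finite_induct) (simp_all add: mult_monom)
  have const: "(\<Prod>k\<in>I. [:a k:]) = [:\<Prod>k\<in>I. a k:]" for I
    by (induction I rule: infinite_finite_induct) (simp_all add: mult.commute one_pCons)
  have "(\<Prod>k\<in>K. [:a k, b k:]) = (\<Prod>k\<in>K. [:a k:] + [:0, b k:])" by simp
  also have "\<dots> = (\<Sum>I\<in>Pow K. (\<Prod>k\<in>I. [:a k:]) * (\<Prod>k\<in>K - I. [:0, b k:]))"
    by (rule prod_add[OF assms(1)])
  finally have "(\<Prod>k\<in>K. [:a k, b k:])
      = (\<Sum>I\<in>Pow K. Polynomial.smult (\<Prod>k\<in>I. a k) (monom (\<Prod>k\<in>K - I. b k) (card (K - I))))"
    using assms(1) by (simp add: const monom)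
  then have "coeff (\<Prod>k\<in>K. [:a k, b k:]) (card K - i)
      = (\<Sum>I\<in>Pow K. if card (K - I) = card K - i then (\<Prod>k\<in>I. a k) * (\<Prod>k\<in>K - I. b k) else 0)"
    by (simp only: Polynomial.coeff_sum) (auto intro!: sum.cong)
  also have "\<dots> = (\<Sum>I | I \<subseteq> K \<and> card I = i. (\<Prod>k\<in>I. a k) * (\<Prod>k\<in>K - I. b k))"
  proof (rule sum.mono_neutral_cong_right)
    \<comment> \<open>Natural subtraction is injective here because both \<open>card I\<close> and
      \<open>i\<close> are at most \<open>card K\<close>.\<close>
    have "card (K - I) = card K - i \<longleftrightarrow> card I = i" if "I \<subseteq> K" for I
      using assms card_mono[OF assms(1) that] card_Diff_subset[OF finite_subset[OF that assms(1)] that] by linarith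
    then show "\<forall>I\<in>Pow K - {I. I \<subseteq> K \<and> card I = i}.
        (if card (K - I) = card K - i then (\<Prod>k\<in>I. a k) * (\<Prod>k\<in>K - I. b k) else 0) = 0"
      and "\<And>I. I \<in> {I. I \<subseteq> K \<and> card I = i} \<Longrightarrow>
        (if card (K - I) = card K - i then (\<Prod>k\<in>I. a k) * (\<Prod>k\<in>K - I. b k) else 0)
          = (\<Prod>k\<in>I. a k) * (\<Prod>k\<in>K - I. b k)" by auto
  qed (use assms in auto)
  finally show ?thesis .
qed

text \<open>Over the complex numbers the characteristic polynomial is the product of the factors
  \<open>x - y\<close> over the latent roots \<open>y\<close> with multiplicity. Its coefficients
  are thus signed elementary symmetric functions of the roots, and they are real because
  \<open>S\<close> is.\<close>

lemma Tr_sym_eq_coeff_char_poly: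
  assumes S: "S \<in> carrier_mat p p" and i: "i \<le> p"
  shows "Tr_sym i S = complex_of_real ((-1) ^ i * coeff (char_poly S) (p - i))"
proof -
  let ?f = "char_poly (map_mat complex_of_real S)"
  let ?ys = "latent_roots S"
  have S': "map_mat complex_of_real S \<in> carrier_mat p p" using S by simp
  have monic: "degree ?f = p" "lead_coeff ?f = 1"
    using degree_monic_char_poly[OF S'] by auto
  have ys: "mset ?ys = proots ?f"
    unfolding latent_roots_def by (rule someI_ex) (rule ex_mset)
  have len: "length ?ys = p"
    using size_proots_complex[of ?f] monic by (simp flip: ys)
  have "?f = (\<Prod>x\<in>#mset ?ys. [:- x, 1:])"
    using complex_poly_decompose_multiset[of ?f] monic by (simp add: ys)
  also have "\<dots> = (\<Prod>x\<leftarrow>?ys. [:- x, 1:])"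
    by (simp flip: prod_mset_prod_list)
  also have "\<dots> = (\<Prod>j\<in>{..<p}. [:- (?ys ! j), 1:])"
    using len by (simp add: prod.list_conv_set_nth atLeast0LessThan)
  finally have "coeff ?f (card {..<p} - i) = (\<Sum>J | J \<subseteq> {..<p} \<and> card J = i. (\<Prod>j\<in>J. - (?ys ! j)))"
    using coeff_prod_linear[of "{..<p}" i "\<lambda>j. - (?ys ! j)" "\<lambda>_. 1"] i by simp
  also have "\<dots> = (\<Sum>J | J \<subseteq> {..<p} \<and> card J = i. (-1) ^ i * (\<Prod>j\<in>J. ?ys ! j))"
    by (intro sum.cong refl) (auto simp: prod_uminus)
  also have "\<dots> = (-1) ^ i * Tr_sym i S"
    unfolding Tr_sym_def elem_sym_def len by (simp add: sum_distrib_left)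
  finally have "coeff ?f (p - i) = (-1) ^ i * Tr_sym i S" by simp
  moreover have "?f = map_poly complex_of_real (char_poly S)"
    by (rule of_real_hom.char_poly_hom[OF S])
  ultimately have "(-1) ^ i * complex_of_real (coeff (char_poly S) (p - i)) = (-1) ^ i * ((-1) ^ i * Tr_sym i S)"
    by (simp add: coeff_map_poly)
  then show ?thesis by (simp add: mult.assoc[symmetric] flip: power_mult_distrib)
qed

text \<open>In the Leibniz expansion the factor at \<open>k\<close> has linear coefficient
  \<open>1\<close> if \<open>\<pi>\<close> fixes \<open>k\<close> and \<open>0\<close> otherwise.
  Taking linear terms outside \<open>I\<close> forces \<open>\<pi>\<close> to permute
  \<open>I\<close>, so the sum over such \<open>\<pi>\<close> is the principal minor on
  \<open>I\<close>.\<close>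

lemma coeff_char_poly_eq_principal_minors:
  fixes A :: "'a::comm_ring_1 mat"
  assumes A: "A \<in> carrier_mat p p" and i: "i \<le> p"
  shows "(-1) ^ i * coeff (char_poly A) (p - i)
    = (\<Sum>I | I \<subseteq> {..<p} \<and> card I = i. \<Sum>\<pi> | \<pi> permutes I. signof \<pi> * (\<Prod>k\<in>I. A $$ (k, \<pi> k)))"
proof -
  let ?S = "{\<pi>. \<pi> permutes {..<p}}" and ?I = "{I. I \<subseteq> {..<p} \<and> card I = i}"
  have coeff: "coeff (\<Prod>k<p. [:a k, b k:]) (p - i)
      = (\<Sum>I\<in>?I. (\<Prod>k\<in>I. a k) * (\<Prod>k\<in>{..<p} - I. b k))" for a b :: "nat \<Rightarrow> 'a"
    using coeff_prod_linear[of "{..<p}" i a b] i by simp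
  have "char_poly A = (\<Sum>\<pi>\<in>?S. signof \<pi> * (\<Prod>k<p. [:- A $$ (k, \<pi> k), if k = \<pi> k then 1 else 0:]))"
    unfolding char_poly_def det_def'[OF char_poly_matrix_closed[OF A]] atLeast0LessThan
  proof (intro sum.cong refl arg_cong2[where f = "(*)"] prod.cong)
    fix \<pi> k assume "\<pi> \<in> ?S" "k \<in> {..<p}"
    then have "k < p" "\<pi> k < p" using permutes_in_image[of \<pi> "{..<p}" k] by auto
    then show "char_poly_matrix A $$ (k, \<pi> k) = [:- A $$ (k, \<pi> k), if k = \<pi> k then 1 else 0:]"
      using A by (auto simp: char_poly_matrix_def)
  qed
  then have "coeff (char_poly A) (p - i)
      = (\<Sum>\<pi>\<in>?S. signof \<pi> * coeff (\<Prod>k<p. [:- A $$ (k, \<pi> k), if k = \<pi> k then 1 else 0:]) (p - i))"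
    by (simp add: Polynomial.coeff_sum of_int_poly)
  also have "\<dots> = (\<Sum>\<pi>\<in>?S. signof \<pi> * (\<Sum>I\<in>?I. (\<Prod>k\<in>I. - A $$ (k, \<pi> k)) * (\<Prod>k\<in>{..<p} - I. if k = \<pi> k then 1 else 0)))"
    unfolding coeff ..
  also have "\<dots> = (\<Sum>I\<in>?I. \<Sum>\<pi>\<in>?S. signof \<pi> * ((\<Prod>k\<in>I. - A $$ (k, \<pi> k)) * (\<Prod>k\<in>{..<p} - I. if k = \<pi> k then 1 else 0)))"
    by (subst sum.swap) (simp add: sum_distrib_left)
  also have "\<dots> = (\<Sum>I\<in>?I. \<Sum>\<pi> | \<pi> permutes I. signof \<pi> * ((-1) ^ i * (\<Prod>k\<in>I. A $$ (k, \<pi> k))))"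
  proof (rule sum.cong[OF refl])
    fix I assume I: "I \<in> ?I"
    show "(\<Sum>\<pi>\<in>?S. signof \<pi> * ((\<Prod>k\<in>I. - A $$ (k, \<pi> k)) * (\<Prod>k\<in>{..<p} - I. if k = \<pi> k then 1 else 0)))
        = (\<Sum>\<pi> | \<pi> permutes I. signof \<pi> * ((-1) ^ i * (\<Prod>k\<in>I. A $$ (k, \<pi> k))))"
    proof (rule sum.mono_neutral_cong_right)
      show "finite ?S" by (simp add: finite_permutations)
      show "{\<pi>. \<pi> permutes I} \<subseteq> ?S" using I permutes_subset by auto
      show "\<forall>\<pi>\<in>?S - {\<pi>. \<pi> permutes I}.
          signof \<pi> * ((\<Prod>k\<in>I. - A $$ (k, \<pi> k)) * (\<Prod>k\<in>{..<p} - I. if k = \<pi> k then 1 else 0)) = 0"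
      proof
        fix \<pi> assume "\<pi> \<in> ?S - {\<pi>. \<pi> permutes I}"
        then have "\<not> (\<forall>k\<in>{..<p} - I. \<pi> k = k)" using permutes_superset[of \<pi> "{..<p}" I] by blast
        then obtain k where "k \<in> {..<p} - I" "k \<noteq> \<pi> k" by metis
        then have "(\<Prod>k\<in>{..<p} - I. if k = \<pi> k then 1 else (0::'a)) = 0" by (intro prod_zero) auto
        then show "signof \<pi> * ((\<Prod>k\<in>I. - A $$ (k, \<pi> k)) * (\<Prod>k\<in>{..<p} - I. if k = \<pi> k then 1 else 0)) = 0"
          by simp
      qed
      fix \<pi> assume \<pi>: "\<pi> \<in> {\<pi>. \<pi> permutes I}"
      have "(\<Prod>k\<in>{..<p} - I. if k = \<pi> k then 1 else (0::'a)) = 1"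
        using \<pi> by (intro prod.neutral) (auto simp: permutes_not_in)
      moreover have "(\<Prod>k\<in>I. - A $$ (k, \<pi> k)) = (-1) ^ i * (\<Prod>k\<in>I. A $$ (k, \<pi> k))"
        using I by (simp add: prod_uminus)
      ultimately show "signof \<pi> * ((\<Prod>k\<in>I. - A $$ (k, \<pi> k)) * (\<Prod>k\<in>{..<p} - I. if k = \<pi> k then 1 else 0))
          = signof \<pi> * ((-1) ^ i * (\<Prod>k\<in>I. A $$ (k, \<pi> k)))" by simp
    qed
  qed
  also have "\<dots> = (-1) ^ i * (\<Sum>I\<in>?I. \<Sum>\<pi> | \<pi> permutes I. signof \<pi> * (\<Prod>k\<in>I. A $$ (k, \<pi> k)))"
    by (simp add: sum_distrib_left mult_ac)
  finally show ?thesis by (simp add: mult.assoc[symmetric] flip: power_mult_distrib)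
qed

section \<open>Principal minors of a Gram matrix\<close>

text \<open>A determinant with two equal columns vanishes. Composing \<open>\<pi>\<close> with the
  transposition of two indices having the same \<open>f\<close>-value reverses the sign and
  preserves the product, so the sum equals its own negative.\<close>

lemma alternating_sum_repeated_index:
  fixes g :: "'a \<Rightarrow> 'b \<Rightarrow> 'c::linordered_idom"
  assumes I: "finite I" and f: "\<not> inj_on f I"
  shows "(\<Sum>\<pi> | \<pi> permutes I. of_int (sign \<pi>) * (\<Prod>k\<in>I. g (\<pi> k) (f k))) = 0" (is "?s = 0")
proof -
  obtain a b where ab: "a \<in> I" "b \<in> I" "a \<noteq> b" "f a = f b" using f by (auto simp: inj_on_def)
  let ?t = "transpose a b"
  have t: "?t permutes I" using ab by (simp add: permutes_swap_id)
  have ft: "f (?t k) = f k" for k using ab by (auto simp: Transposition.transpose_def)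
  have "?s = (\<Sum>\<pi> | \<pi> permutes I. of_int (sign (\<pi> \<circ> ?t)) * (\<Prod>k\<in>I. g ((\<pi> \<circ> ?t) k) (f k)))"
    by (rule sum_permutations_compose_right[OF t])
  also have "\<dots> = (\<Sum>\<pi> | \<pi> permutes I. - (of_int (sign \<pi>) * (\<Prod>k\<in>I. g (\<pi> k) (f k))))"
  proof (rule sum.cong[OF refl])
    fix \<pi> assume "\<pi> \<in> {\<pi>. \<pi> permutes I}"
    then have "permutation \<pi>" using I by (auto simp: permutation_permutes)
    then have "sign (\<pi> \<circ> ?t) = - sign \<pi>"
      using ab by (simp add: sign_compose permutation_swap_id sign_swap_id)
    moreover have "(\<Prod>k\<in>I. g ((\<pi> \<circ> ?t) k) (f k)) = (\<Prod>k\<in>I. g (\<pi> k) (f k))"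
    proof -
      have "(\<Prod>k\<in>I. g (\<pi> k) (f k)) = (\<Prod>k\<in>I. g (\<pi> (?t k)) (f (?t k)))"
        by (rule prod.reindex_bij_betw[OF permutes_imp_bij[OF t], symmetric])
      then show ?thesis by (simp add: ft)
    qed
    ultimately show "of_int (sign (\<pi> \<circ> ?t)) * (\<Prod>k\<in>I. g ((\<pi> \<circ> ?t) k) (f k))
        = - (of_int (sign \<pi>) * (\<Prod>k\<in>I. g (\<pi> k) (f k)))" by simp
  qed
  finally have "?s = - ?s" by (simp add: sum_negf)
  then show ?thesis by (simp only: equal_neg_zero)
qed

text \<open>An expanded form of the Cauchy-Binet formula. Multiplying out the entries of
  \<open>N * N\<^sup>T\<close> selects a column \<open>f k\<close> for each row \<open>k\<close>;
  selections with a repeated column cancel in the alternating sum, which affects only the second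
  product.\<close>

lemma principal_minor_gram:
  fixes N :: "real mat"
  assumes N: "N \<in> carrier_mat p n" and I: "I \<subseteq> {..<p}"
  shows "(\<Sum>\<pi> | \<pi> permutes I. signof \<pi> * (\<Prod>k\<in>I. (N * N\<^sup>T) $$ (k, \<pi> k)))
    = (\<Sum>f | f \<in> I \<rightarrow>\<^sub>E {..<n} \<and> inj_on f I. \<Sum>\<pi> | \<pi> permutes I. signof \<pi> *
        ((\<Prod>k\<in>I. N $$ (k, f k)) * (\<Prod>k\<in>I. N $$ (\<pi> k, f k))))"
proof -
  have finI: "finite I" using I finite_subset by auto
  have "(\<Prod>k\<in>I. (N * N\<^sup>T) $$ (k, \<pi> k)) = (\<Sum>f\<in>I \<rightarrow>\<^sub>E {..<n}. (\<Prod>k\<in>I. N $$ (k, f k)) * (\<Prod>k\<in>I. N $$ (\<pi> k, f k)))"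
    if "\<pi> permutes I" for \<pi>
  proof -
    have "(N * N\<^sup>T) $$ (k, \<pi> k) = (\<Sum>l<n. N $$ (k, l) * N $$ (\<pi> k, l))" if "k \<in> I" for k
    proof -
      have "k < p" "\<pi> k < p" using that I permutes_in_image[OF \<open>\<pi> permutes I\<close>, of k] by auto
      then show ?thesis using N by (simp add: scalar_prod_def atLeast0LessThan)
    qed
    then have "(\<Prod>k\<in>I. (N * N\<^sup>T) $$ (k, \<pi> k)) = (\<Prod>k\<in>I. \<Sum>l<n. N $$ (k, l) * N $$ (\<pi> k, l))" by simp
    also have "\<dots> = (\<Sum>f\<in>I \<rightarrow>\<^sub>E {..<n}. \<Prod>k\<in>I. N $$ (k, f k) * N $$ (\<pi> k, f k))"
      by (rule prod_sum_PiE[OF finI]) simp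
    finally show ?thesis by (simp add: prod.distrib)
  qed
  then have "(\<Sum>\<pi> | \<pi> permutes I. signof \<pi> * (\<Prod>k\<in>I. (N * N\<^sup>T) $$ (k, \<pi> k)))
      = (\<Sum>\<pi> | \<pi> permutes I. \<Sum>f\<in>I \<rightarrow>\<^sub>E {..<n}. signof \<pi> * ((\<Prod>k\<in>I. N $$ (k, f k)) * (\<Prod>k\<in>I. N $$ (\<pi> k, f k))))"
    by (simp add: sum_distrib_left)
  also have "\<dots> = (\<Sum>f\<in>I \<rightarrow>\<^sub>E {..<n}. \<Sum>\<pi> | \<pi> permutes I. signof \<pi> * ((\<Prod>k\<in>I. N $$ (k, f k)) * (\<Prod>k\<in>I. N $$ (\<pi> k, f k))))"
    by (rule sum.swap)
  also have "\<dots> = (\<Sum>f | f \<in> I \<rightarrow>\<^sub>E {..<n} \<and> inj_on f I. \<Sum>\<pi> | \<pi> permutes I. signof \<pi> *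
        ((\<Prod>k\<in>I. N $$ (k, f k)) * (\<Prod>k\<in>I. N $$ (\<pi> k, f k))))"
  proof (rule sum.mono_neutral_right)
    show "\<forall>f\<in>(I \<rightarrow>\<^sub>E {..<n}) - {f \<in> I \<rightarrow>\<^sub>E {..<n}. inj_on f I}.
        (\<Sum>\<pi> | \<pi> permutes I. signof \<pi> * ((\<Prod>k\<in>I. N $$ (k, f k)) * (\<Prod>k\<in>I. N $$ (\<pi> k, f k)))) = 0"
    proof
      fix f assume "f \<in> (I \<rightarrow>\<^sub>E {..<n}) - {f \<in> I \<rightarrow>\<^sub>E {..<n}. inj_on f I}"
      then have "(\<Sum>\<pi> | \<pi> permutes I. signof \<pi> * (\<Prod>k\<in>I. N $$ (\<pi> k, f k))) = 0"
        using alternating_sum_repeated_index[OF finI, of f "\<lambda>a b. N $$ (a, b)"] by auto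
      then have "(\<Prod>k\<in>I. N $$ (k, f k)) * (\<Sum>\<pi> | \<pi> permutes I. signof \<pi> * (\<Prod>k\<in>I. N $$ (\<pi> k, f k))) = 0" by simp
      then show "(\<Sum>\<pi> | \<pi> permutes I. signof \<pi> * ((\<Prod>k\<in>I. N $$ (k, f k)) * (\<Prod>k\<in>I. N $$ (\<pi> k, f k)))) = 0"
        by (simp add: sum_distrib_left mult_ac)
    qed
  qed (use finI in \<open>auto intro: finite_PiE\<close>)
  finally show ?thesis .
qed


subsection \<open>Orthogonal rotations of Gaussian matrices\<close>

lemma index_mult_mat_3:
  fixes A B C :: "'a::semiring_0 mat"
  assumes "A \<in> carrier_mat p p'" "B \<in> carrier_mat p' n'" "C \<in> carrier_mat n' n" "k < p" "l < n"
  shows "(A * B * C) $$ (k, l) = (\<Sum>j\<in>{..<p'} \<times> {..<n'}. A $$ (k, fst j) * B $$ j * C $$ (snd j, l))"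
proof -
  have "(A * B * C) $$ (k, l) = (\<Sum>a<p'. A $$ (k, a) * (\<Sum>b<n'. B $$ (a, b) * C $$ (b, l)))"
    using assms by (simp add: scalar_prod_def atLeast0LessThan)
  also have "\<dots> = (\<Sum>a<p'. \<Sum>b<n'. A $$ (k, a) * B $$ (a, b) * C $$ (b, l))"
    by (simp add: sum_distrib_left mult.assoc)
  also have "\<dots> = (\<Sum>j\<in>{..<p'} \<times> {..<n'}. A $$ (k, fst j) * B $$ j * C $$ (snd j, l))"
    unfolding sum.cartesian_product by (rule sum.cong) auto
  finally show ?thesis .
qed

text \<open>Left multiplication by \<open>P\<^sup>T\<close> and right multiplication by
  \<open>Q\<close> have as adjoints, for the entrywise inner product, multiplication by
  \<open>P\<close> and by \<open>Q\<^sup>T\<close>. Commutativity is all that is used of the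
  entries, so the lemma applies to real and to umbral matrices.\<close>

lemma frobenius_adjoint:
  fixes A Z P Q :: "'a::comm_semiring_1 mat"
  assumes "P \<in> carrier_mat p p" "Q \<in> carrier_mat n n" "A \<in> carrier_mat p n" "Z \<in> carrier_mat p n"
  shows "(\<Sum>j\<in>{..<p} \<times> {..<n}. Z $$ j * (P\<^sup>T * A * Q) $$ j) = (\<Sum>j\<in>{..<p} \<times> {..<n}. A $$ j * (P * Z * Q\<^sup>T) $$ j)"
proof -
  let ?J = "{..<p} \<times> {..<n}"
  have left: "(P\<^sup>T * A * Q) $$ j = (\<Sum>r\<in>?J. P $$ (fst r, fst j) * A $$ r * Q $$ (snd r, snd j))" if "j \<in> ?J" for j
  proof -
    have "(P\<^sup>T * A * Q) $$ (fst j, snd j) = (\<Sum>r\<in>?J. P\<^sup>T $$ (fst j, fst r) * A $$ r * Q $$ (snd r, snd j))"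
      by (rule index_mult_mat_3) (use assms that in auto)
    also have "\<dots> = (\<Sum>r\<in>?J. P $$ (fst r, fst j) * A $$ r * Q $$ (snd r, snd j))"
      by (rule sum.cong) (use assms that in auto)
    finally show ?thesis by simp
  qed
  have right: "(P * Z * Q\<^sup>T) $$ r = (\<Sum>j\<in>?J. P $$ (fst r, fst j) * Z $$ j * Q $$ (snd r, snd j))" if "r \<in> ?J" for r
  proof -
    have "(P * Z * Q\<^sup>T) $$ (fst r, snd r) = (\<Sum>j\<in>?J. P $$ (fst r, fst j) * Z $$ j * Q\<^sup>T $$ (snd j, snd r))"
      by (rule index_mult_mat_3) (use assms that in auto)
    also have "\<dots> = (\<Sum>j\<in>?J. P $$ (fst r, fst j) * Z $$ j * Q $$ (snd r, snd j))"
      by (rule sum.cong) (use assms that in auto)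
    finally show ?thesis by simp
  qed
  have "(\<Sum>j\<in>?J. Z $$ j * (P\<^sup>T * A * Q) $$ j)
      = (\<Sum>j\<in>?J. \<Sum>r\<in>?J. Z $$ j * (P $$ (fst r, fst j) * A $$ r * Q $$ (snd r, snd j)))"
    by (simp only: left sum_distrib_left cong: sum.cong)
  also have "\<dots> = (\<Sum>r\<in>?J. \<Sum>j\<in>?J. A $$ r * (P $$ (fst r, fst j) * Z $$ j * Q $$ (snd r, snd j)))"
    by (subst sum.swap) (simp add: mult_ac)
  also have "\<dots> = (\<Sum>r\<in>?J. A $$ r * (P * Z * Q\<^sup>T) $$ r)"
    by (simp only: right sum_distrib_left cong: sum.cong)
  finally show ?thesis .
qed

lemma orthogonal_cancel:
  assumes P: "orthogonal_of_order p P" and Q: "orthogonal_of_order n Q" and Z: "Z \<in> carrier_mat p n"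
  shows "P\<^sup>T * (P * Z * Q\<^sup>T) * Q = Z"
proof -
  have c: "P \<in> carrier_mat p p" "Q \<in> carrier_mat n n" "P\<^sup>T * P = 1\<^sub>m p" "Q\<^sup>T * Q = 1\<^sub>m n"
    using P Q by (auto simp: orthogonal_of_order_def)
  have "P\<^sup>T * (P * Z * Q\<^sup>T) * Q = (P\<^sup>T * P) * Z * (Q\<^sup>T * Q)"
    using c(1,2) Z by (simp add: assoc_mult_mat[of _ p p _ p _ n] assoc_mult_mat[of _ p p _ n _ n] assoc_mult_mat[of _ p n _ n _ n])
  then show ?thesis using c Z by simp
qed

lemma vectorize_inner:
  fixes A B :: "'a::semiring_0 mat"
  assumes "A \<in> carrier_mat p n" "B \<in> carrier_mat p n"
  shows "vectorize A \<bullet> vectorize B = (\<Sum>j\<in>{..<p} \<times> {..<n}. A $$ j * B $$ j)"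
proof -
  have "vectorize A \<bullet> vectorize B = (\<Sum>k<p * n. A $$ (k mod p, k div p) * B $$ (k mod p, k div p))"
    using assms by (simp add: vectorize_def scalar_prod_def atLeast0LessThan)
  also have "\<dots> = (\<Sum>j\<in>{..<p} \<times> {..<n}. A $$ j * B $$ j)"
  \<comment> \<open>Column stacking places the entry in row \<open>k\<close> and column
    \<open>l\<close> at position \<open>l * p + k\<close>.\<close>
  proof (rule sum.reindex_bij_witness[of _ "\<lambda>j. snd j * p + fst j" "\<lambda>k. (k mod p, k div p)"])
    fix j assume j: "j \<in> {..<p} \<times> {..<n}"
    then have "snd j * p + fst j < Suc (snd j) * p" by auto
    also have "\<dots> \<le> n * p" using j by (intro mult_le_mono1) auto
    finally show "snd j * p + fst j \<in> {..<p * n}" by (simp add: mult.commute)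
    show "((snd j * p + fst j) mod p, (snd j * p + fst j) div p) = j" using j by (cases j) auto
  next
    fix k assume k: "k \<in> {..<p * n}"
    then have "0 < p" by (cases p) auto
    then show "(k mod p, k div p) \<in> {..<p} \<times> {..<n}"
      using k by (auto simp: less_mult_imp_div_less mult.commute)
  qed auto
  finally show ?thesis .
qed

lemma kronecker_scaled_identity:
  fixes s :: "'a::semiring_1"
  shows "kronecker (1\<^sub>m n) (s \<cdot>\<^sub>m 1\<^sub>m p) = s \<cdot>\<^sub>m 1\<^sub>m (n * p)"
proof (rule eq_matI)
  fix i j assume "i < dim_row (s \<cdot>\<^sub>m 1\<^sub>m (n * p))" "j < dim_col (s \<cdot>\<^sub>m 1\<^sub>m (n * p))"
  then have ij: "i < n * p" "j < n * p" by auto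
  then have "0 < p" by (cases p) auto
  with ij have "i div p < n" "j div p < n" "i mod p < p" "j mod p < p"
    by (simp_all add: less_mult_imp_div_less)
  moreover have "i = j" if "i div p = j div p" "i mod p = j mod p"
    using that by (metis div_mult_mod_eq)
  ultimately show "kronecker (1\<^sub>m n) (s \<cdot>\<^sub>m 1\<^sub>m p) $$ (i, j) = (s \<cdot>\<^sub>m 1\<^sub>m (n * p)) $$ (i, j)"
    using ij by (auto simp: kronecker_def)
qed (auto simp: kronecker_def)

lemma scaled_identity_quadratic_form:
  fixes x :: "'a::comm_semiring_1 vec"
  assumes "x \<in> carrier_vec k"
  shows "x \<bullet> ((s \<cdot>\<^sub>m 1\<^sub>m k) *\<^sub>v x) = s * (x \<bullet> x)"
proof -
  have "(s \<cdot>\<^sub>m 1\<^sub>m k) *\<^sub>v x = s \<cdot>\<^sub>v x"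
    using assms by (intro eq_vecI) (auto simp: scalar_prod_def if_distrib if_distribR cong: if_cong)
  then show ?thesis using assms by simp
qed

text \<open>Identifies the exponent of the umbral generating function as a linear form in the
  entries; it also expands the trace of \<open>Y * Y\<^sup>T\<close> into squares.\<close>

lemma mtrace_transpose_mult:
  fixes A B :: "'a::semiring_0 mat"
  assumes "A \<in> carrier_mat p n" "B \<in> carrier_mat p n"
  shows "mtrace (A\<^sup>T * B) = (\<Sum>j\<in>{..<p} \<times> {..<n}. A $$ j * B $$ j)"
proof -
  have "mtrace (A\<^sup>T * B) = (\<Sum>l<n. \<Sum>k<p. A $$ (k, l) * B $$ (k, l))"
    using assms by (simp add: mtrace_def scalar_prod_def atLeast0LessThan)
  also have "\<dots> = (\<Sum>k<p. \<Sum>l<n. A $$ (k, l) * B $$ (k, l))" by (rule sum.swap)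
  finally show ?thesis unfolding sum.cartesian_product by (simp add: case_prod_unfold)
qed

lemma semiring_hom_uconst: "semiring_hom uconst"
  by unfold_locales (simp_all add: uconst_0 uconst_1 uconst_add uconst_mult)

text \<open>The linear form with coefficients \<open>Z\<close> in \<open>P\<^sup>T X Q\<close> is the linear form with coefficients
  \<open>P Z Q\<^sup>T\<close> in \<open>X\<close>. This identity gives its mean, and for \<open>D = Z\<close> its variance.\<close>

lemma rotated_parameters:
  assumes P: "orthogonal_of_order p P" and Q: "orthogonal_of_order n Q"
    and D: "D \<in> carrier_mat p n" and Z: "Z \<in> carrier_mat p n"
  shows "(\<Sum>j\<in>{..<p} \<times> {..<n}. (P * D * Q\<^sup>T) $$ j * (P * Z * Q\<^sup>T) $$ j) = (\<Sum>j\<in>{..<p} \<times> {..<n}. Z $$ j * D $$ j)"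
proof -
  have c: "P \<in> carrier_mat p p" "Q \<in> carrier_mat n n"
    using P Q by (auto simp: orthogonal_of_order_def)
  have "P * D * Q\<^sup>T \<in> carrier_mat p n" using c D by auto
  from frobenius_adjoint[OF c this Z] show ?thesis
    by (simp add: orthogonal_cancel[OF P Q D])
qed

section \<open>Linear forms in the rotated umbral and random matrices\<close>

text \<open>Evaluate the generating function of \<open>X\<close> at
  \<open>P * Z * Q\<^sup>T\<close>, with \<open>z\<close> as the entries of \<open>Z\<close>.
  Orthogonality turns its linear and quadratic coefficients into the stated mean and half the stated
  variance, and the coefficient of index \<open>k\<close> gives the moment.\<close>

lemma normal_umbral_matrix_rotated_moments:
  fixes X :: "'u umbral_poly mat"
  assumes P: "orthogonal_of_order p P" and Q: "orthogonal_of_order n Q" and D: "D \<in> carrier_mat p n"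
    and X: "normal_umbral_matrix E p n (P * D * Q\<^sup>T) (s \<cdot>\<^sub>m 1\<^sub>m p) X"
  shows "E ((\<Sum>j\<in>{..<p} \<times> {..<n}. uconst (z j) * (map_mat uconst (P\<^sup>T) * X * map_mat uconst Q) $$ j) ^ k)
    = normal_moment (\<Sum>j\<in>{..<p} \<times> {..<n}. z j * D $$ j) (s * (\<Sum>j\<in>{..<p} \<times> {..<n}. (z j)\<^sup>2)) k"
proof -
  let ?J = "{..<p} \<times> {..<n}"
  define Z where "Z = Matrix.mat p n z"
  define Z' where "Z' = P * Z * Q\<^sup>T"
  let ?h = "map_mat (uconst :: real \<Rightarrow> 'u umbral_poly)"
  interpret uconst: semiring_hom "uconst :: real \<Rightarrow> 'u umbral_poly"
    by (rule semiring_hom_uconst)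
  have c: "P \<in> carrier_mat p p" "Q \<in> carrier_mat n n"
    using P Q by (auto simp: orthogonal_of_order_def)
  have Z: "Z \<in> carrier_mat p n" and Z': "Z' \<in> carrier_mat p n" using c by (auto simp: Z_def Z'_def)
  have Xc: "X \<in> carrier_mat p n" using X by (simp add: normal_umbral_matrix_def)
  have Zj: "Z $$ j = z j" if "j \<in> ?J" for j using that by (auto simp: Z_def)
  have hZ': "?h Z' = ?h P * ?h Z * (?h Q)\<^sup>T"
    unfolding Z'_def using c Z
    by (simp add: uconst.mat_hom_mult[of _ p n _ n] uconst.mat_hom_mult[of _ p p _ n] map_mat_transpose)
  have "(\<Sum>j\<in>?J. uconst (z j) * (?h (P\<^sup>T) * X * ?h Q) $$ j) = (\<Sum>j\<in>?J. ?h Z $$ j * ((?h P)\<^sup>T * X * ?h Q) $$ j)"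
    using Z Zj by (intro sum.cong refl) (auto simp: map_mat_transpose)
  also have "\<dots> = (\<Sum>j\<in>?J. X $$ j * ?h Z' $$ j)"
    unfolding hZ' by (rule frobenius_adjoint) (use c Z Xc in auto)
  also have "\<dots> = mtrace (X\<^sup>T * ?h Z')"
    by (rule mtrace_transpose_mult[symmetric]) (use Xc Z' in auto)
  finally have form: "(\<Sum>j\<in>?J. uconst (z j) * (?h (P\<^sup>T) * X * ?h Q) $$ j) = mtrace (X\<^sup>T * ?h Z')" .
  have mean: "vectorize (P * D * Q\<^sup>T) \<bullet> vectorize Z' = (\<Sum>j\<in>?J. z j * D $$ j)"
    using vectorize_inner[of "P * D * Q\<^sup>T" p n Z'] rotated_parameters[OF P Q D Z] c D Z' Zj
    by (simp add: Z'_def)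
  have "vectorize Z' \<in> carrier_vec (n * p)" using Z' by (auto simp: vectorize_def)
  from scaled_identity_quadratic_form[OF this, of s]
  have var: "vectorize Z' \<bullet> (kronecker (1\<^sub>m n) (s \<cdot>\<^sub>m 1\<^sub>m p) *\<^sub>v vectorize Z') = s * (\<Sum>j\<in>?J. (z j)\<^sup>2)"
    unfolding kronecker_scaled_identity
    using vectorize_inner[OF Z' Z'] rotated_parameters[OF P Q Z Z] Zj
    by (simp add: Z'_def power2_eq_square)
  have "fps_nth (umbral_gf E (mtrace (X\<^sup>T * ?h Z'))) k = normal_moment (\<Sum>j\<in>?J. z j * D $$ j) (s * (\<Sum>j\<in>?J. (z j)\<^sup>2)) k / fact k"
    using X Z' unfolding normal_umbral_matrix_def normal_moment_def by (simp add: mean var)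
  then show ?thesis unfolding form umbral_gf_def by simp
qed

lemma normal_rv_cong:
  assumes "\<And>\<omega>. \<omega> \<in> space M \<Longrightarrow> f \<omega> = g \<omega>"
  shows "normal_rv M f \<mu> v \<longleftrightarrow> normal_rv M g \<mu> v"
  unfolding normal_rv_def using assms measurable_cong[of M f g borel] distr_cong[of M M borel borel f g] by simp

text \<open>As a form in \<open>X\<close>, with coefficients \<open>Z' = P * Z * Q\<^sup>T\<close>,
  the sum splits into one linear form per column. These are normal by \<open>gaussian_vector\<close>
  and independent because the columns are.\<close>

lemma gaussian_matrix_rotated_linear_form:
  assumes P: "orthogonal_of_order p P" and Q: "orthogonal_of_order n Q" and D: "D \<in> carrier_mat p n"
    and X: "gaussian_matrix \<Omega> p n (P * D * Q\<^sup>T) (s \<cdot>\<^sub>m 1\<^sub>m p) X" and s: "0 < s"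
  shows "normal_rv \<Omega> (\<lambda>\<omega>. \<Sum>j\<in>{..<p} \<times> {..<n}. z j * (P\<^sup>T * X \<omega> * Q) $$ j)
    (\<Sum>j\<in>{..<p} \<times> {..<n}. z j * D $$ j) (s * (\<Sum>j\<in>{..<p} \<times> {..<n}. (z j)\<^sup>2))"
proof -
  let ?J = "{..<p} \<times> {..<n}"
  let ?M = "P * D * Q\<^sup>T"
  define Z where "Z = Matrix.mat p n z"
  define Z' where "Z' = P * Z * Q\<^sup>T"
  have c: "P \<in> carrier_mat p p" "Q \<in> carrier_mat n n"
    using P Q by (auto simp: orthogonal_of_order_def)
  have Z: "Z \<in> carrier_mat p n" and Z': "Z' \<in> carrier_mat p n" using c by (auto simp: Z_def Z'_def)
  have Zj: "Z $$ j = z j" if "j \<in> ?J" for j using that by (auto simp: Z_def)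
  have M: "?M \<in> carrier_mat p n" using c D by auto
  interpret prob_space \<Omega> using X by (simp add: gaussian_matrix_def)
  have Xc: "X \<omega> \<in> carrier_mat p n" if "\<omega> \<in> space \<Omega>" for \<omega>
    using X that by (simp add: gaussian_matrix_def)
  have cols: "(\<Sum>b<n. \<Sum>a<p. A $$ (a, b) * B $$ (a, b)) = (\<Sum>j\<in>?J. A $$ j * B $$ j)" for A B :: "real mat"
    by (subst sum.swap) (simp add: sum.cartesian_product case_prod_unfold)
  define Y where "Y b \<omega> = (\<Sum>a<p. Z' $$ (a, b) * X \<omega> $$ (a, b))" for b \<omega>
  define \<mu> where "\<mu> b = (\<Sum>a<p. ?M $$ (a, b) * Z' $$ (a, b))" for b
  define v where "v b = s * (\<Sum>a<p. Z' $$ (a, b) * Z' $$ (a, b))" for b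
  \<comment> \<open>As \<open>s\<close> is positive, a column form of variance \<open>0\<close> has
    only zero coefficients; this meets the conditions on degenerate summands.\<close>
  have zero: "Z' $$ (a, b) = 0" if "v b = 0" "a < p" for a b
  proof -
    have "(\<Sum>a<p. Z' $$ (a, b) * Z' $$ (a, b)) = 0" using that s by (simp add: v_def)
    then have "\<forall>a\<in>{..<p}. Z' $$ (a, b) * Z' $$ (a, b) = 0"
      by (subst (asm) sum_nonneg_eq_0_iff) auto
    then show ?thesis using that by simp
  qed
  have "normal_rv \<Omega> (\<lambda>\<omega>. \<Sum>b<n. Y b \<omega>) (\<Sum>b<n. \<mu> b) (\<Sum>b<n. v b)"
  proof (rule normal_rv_sum_indep)
    have "indep_vars (\<lambda>_. \<Pi>\<^sub>M i\<in>{..<p}. (borel :: real measure)) (\<lambda>j \<omega>. \<lambda>i\<in>{..<p}. X \<omega> $$ (i, j)) {..<n}"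
      using X by (simp add: gaussian_matrix_def)
    then have "indep_vars (\<lambda>_. borel) (\<lambda>b \<omega>. \<Sum>a<p. Z' $$ (a, b) * (\<lambda>i\<in>{..<p}. X \<omega> $$ (i, b)) a) {..<n}"
      by (rule indep_vars_compose2[where Y = "\<lambda>b y. \<Sum>a<p. Z' $$ (a, b) * y a"]) measurable
    then show "indep_vars (\<lambda>_. borel) Y {..<n}" by (simp add: Y_def[abs_def])
    fix b assume b: "b \<in> {..<n}"
    then have "gaussian_vector \<Omega> p (col ?M b) (s \<cdot>\<^sub>m 1\<^sub>m p) (\<lambda>\<omega>. col (X \<omega>) b)"
      using X by (simp add: gaussian_matrix_def)
    then have "normal_rv \<Omega> (\<lambda>\<omega>. col Z' b \<bullet> col (X \<omega>) b) (col Z' b \<bullet> col ?M b) (col Z' b \<bullet> ((s \<cdot>\<^sub>m 1\<^sub>m p) *\<^sub>v col Z' b))"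
      using col_dim[of Z' b] Z' by (simp add: gaussian_vector_def)
    moreover have "col Z' b \<bullet> col A b = (\<Sum>a<p. Z' $$ (a, b) * A $$ (a, b))" if "A \<in> carrier_mat p n" for A
      using that Z' b by (simp add: scalar_prod_def atLeast0LessThan)
    moreover have "col Z' b \<bullet> ((s \<cdot>\<^sub>m 1\<^sub>m p) *\<^sub>v col Z' b) = s * (col Z' b \<bullet> col Z' b)"
      by (rule scaled_identity_quadratic_form) (use Z' in auto)
    ultimately have "normal_rv \<Omega> (\<lambda>\<omega>. col Z' b \<bullet> col (X \<omega>) b) (\<mu> b) (v b)"
      using M Z' by (simp add: \<mu>_def v_def mult.commute)
    then show "normal_rv \<Omega> (Y b) (\<mu> b) (v b)"
      by (rule iffD1[OF normal_rv_cong, rotated])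
        (use Xc Z' b in \<open>auto simp: Y_def scalar_prod_def atLeast0LessThan dest!: Xc\<close>)
    show "Y b \<omega> = 0" if "v b = 0" for \<omega> using zero[OF that] by (simp add: Y_def)
    show "\<mu> b = 0" if "v b = 0" using zero[OF that] by (simp add: \<mu>_def)
  qed simp
  moreover have "(\<Sum>b<n. \<mu> b) = (\<Sum>j\<in>?J. z j * D $$ j)"
    unfolding \<mu>_def cols using rotated_parameters[OF P Q D Z] Zj by (simp add: Z'_def)
  moreover have "(\<Sum>b<n. v b) = s * (\<Sum>j\<in>?J. (z j)\<^sup>2)"
    unfolding v_def sum_distrib_left[symmetric] cols
    using rotated_parameters[OF P Q Z Z] Zj by (simp add: Z'_def power2_eq_square)
  moreover have "(\<Sum>b<n. Y b \<omega>) = (\<Sum>j\<in>?J. z j * (P\<^sup>T * X \<omega> * Q) $$ j)" if "\<omega> \<in> space \<Omega>" for \<omega>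
  proof -
    have "(\<Sum>b<n. Y b \<omega>) = (\<Sum>j\<in>?J. X \<omega> $$ j * Z' $$ j)"
      unfolding Y_def cols by (simp add: mult.commute)
    also have "\<dots> = (\<Sum>j\<in>?J. Z $$ j * (P\<^sup>T * X \<omega> * Q) $$ j)"
      unfolding Z'_def by (rule frobenius_adjoint[OF c Xc[OF that] Z, symmetric])
    finally show ?thesis using Zj by simp
  qed
  ultimately show ?thesis by (simp add: normal_rv_cong[of \<Omega> "\<lambda>\<omega>. \<Sum>b<n. Y b \<omega>"])
qed


subsection \<open>Elementary symmetric functions and matchings\<close>

text \<open>The two copies of \<open>S\<close> stand for the two factors of each square. As
  \<open>g\<close> is injective, every index in its image occurs exactly twice and contributes a
  second moment; all others contribute \<open>1\<close>.\<close>

lemma polarized_moment_squares: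
  assumes v: "0 < v" and J: "finite J" and S: "finite S" and g: "inj_on g S" "g ` S \<subseteq> J"
  shows "polarized_moment J (S <+> S) (case_sum g g) d v = (\<Prod>t\<in>S. (d (g t))\<^sup>2 + v)"
proof -
  have card: "card {t \<in> S <+> S. case_sum g g t = j} = (if j \<in> g ` S then 2 else 0)" for j
  proof (cases "j \<in> g ` S")
    case True
    then obtain t where t: "t \<in> S" "j = g t" by auto
    have "{r \<in> S <+> S. case_sum g g r = j} = {Inl t, Inr t}"
      using t g(1) by (auto dest: inj_onD)
    then show ?thesis using True by simp
  next
    case False
    then have "{r \<in> S <+> S. case_sum g g r = j} = {}" by auto
    then show ?thesis using False by (simp only: card.empty if_False)
  qed
  have "polarized_moment J (S <+> S) (case_sum g g) d v = (\<Prod>j\<in>J. if j \<in> g ` S then (d j)\<^sup>2 + v else 1)"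
  proof (subst polarized_moment_eq_prod[OF v J])
    show "finite (S <+> S)" "case_sum g g ` (S <+> S) \<subseteq> J" using S g by auto
  qed (auto simp: card intro!: prod.cong)
  also have "\<dots> = (\<Prod>j\<in>g ` S. (d j)\<^sup>2 + v)"
    using g J by (intro prod.mono_neutral_cong_right) auto
  also have "\<dots> = (\<Prod>t\<in>S. (d (g t))\<^sup>2 + v)"
    using g by (simp add: prod.reindex)
  finally show ?thesis .
qed

text \<open>If \<open>\<pi>\<close> moves \<open>k\<close>, the entries \<open>(k, f k)\<close> and \<open>(\<pi> k, f k)\<close> each occur exactly once,
  and one of them is off the diagonal, so its mean vanishes.\<close>

lemma polarized_moment_permuted:
  assumes v: "0 < v" and I: "finite I" "I \<subseteq> A" and B: "finite A" "finite B"
    and f: "f \<in> I \<rightarrow> B" "inj_on f I" and \<pi>: "\<pi> permutes I" "\<pi> \<noteq> id"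
    and d: "\<And>k l. k \<noteq> l \<Longrightarrow> d (k, l) = 0"
  shows "polarized_moment (A \<times> B) (I <+> I) (case_sum (\<lambda>k. (k, f k)) (\<lambda>k. (\<pi> k, f k))) d v = 0"
proof -
  let ?c = "case_sum (\<lambda>k. (k, f k)) (\<lambda>k. (\<pi> k, f k))"
  obtain k where k: "\<pi> k \<noteq> k" using \<pi>(2) by (auto simp: fun_eq_iff)
  then have kI: "k \<in> I" "\<pi> k \<in> I"
    using permutes_not_in[OF \<pi>(1), of k] permutes_in_image[OF \<pi>(1), of k] by auto
  have fk: "\<forall>y\<in>I. f y = f k \<longrightarrow> y = k" using inj_onD[OF f(2)] kI by blast
  have "\<exists>j\<in>A \<times> B. d j = 0 \<and> card {t \<in> I <+> I. ?c t = j} = 1"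
  \<comment> \<open>If \<open>f k \<noteq> k\<close>, the entry \<open>(k, f k)\<close> is off the
    diagonal and is hit by \<open>Inl k\<close> only: a hit by \<open>Inr y\<close> would give
    \<open>y = k\<close> by injectivity, hence \<open>\<pi> k = k\<close>. If
    \<open>f k = k\<close>, the entry \<open>(\<pi> k, k)\<close> plays the same part, hit by
    \<open>Inr k\<close> only.\<close>
  proof (cases "f k = k")
    case False
    have "t = Inl k" if "t \<in> I <+> I" "?c t = (k, f k)" for t
      using that k fk by (elim PlusE) auto
    then have "{t \<in> I <+> I. ?c t = (k, f k)} = {Inl k}" using kI by auto
    then show ?thesis using False d kI f(1) I by (intro bexI[of _ "(k, f k)"]) auto
  next
    case True
    have "t = Inr k" if "t \<in> I <+> I" "?c t = (\<pi> k, f k)" for t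
      using that k fk by (elim PlusE) auto
    then have "{t \<in> I <+> I. ?c t = (\<pi> k, f k)} = {Inr k}" using kI by auto
    then have "card {t \<in> I <+> I. ?c t = (\<pi> k, f k)} = 1" by simp
    moreover have "d (\<pi> k, f k) = 0" using True k by (intro d) metis
    moreover have "(\<pi> k, f k) \<in> A \<times> B" using kI f(1) I by blast
    ultimately show ?thesis by blast
  qed
  then obtain j where j: "j \<in> A \<times> B" "d j = 0" "card {t \<in> I <+> I. ?c t = j} = 1" by blast
  have "?c ` (I <+> I) \<subseteq> A \<times> B" using I f(1) permutes_in_image[OF \<pi>(1)] by auto
  then have "polarized_moment (A \<times> B) (I <+> I) ?c d v
      = (\<Prod>j\<in>A \<times> B. normal_moment (d j) v (card {t \<in> I <+> I. ?c t = j}))"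
    using v I B by (intro polarized_moment_eq_prod) auto
  also have "\<dots> = 0"
  proof (rule prod_zero)
    show "\<exists>j\<in>A \<times> B. normal_moment (d j) v (card {t \<in> I <+> I. ?c t = j}) = 0"
      using j(1) by (rule bexI[rotated]) (simp only: j One_nat_def normal_moment_1)
  qed (use B in simp)
  finally show ?thesis .
qed

text \<open>A partial injection \<open>f\<close> on \<open>I\<close> corresponds to its graph, a set
  of cells with distinct rows and distinct columns. \<open>I\<close> is recovered as the first
  projection of the graph.\<close>

lemma sum_partial_injections_eq_sum_matchings:
  fixes w :: "'a \<times> 'b \<Rightarrow> 'c::comm_semiring_1"
  assumes A: "finite A" and B: "finite B"
  shows "(\<Sum>I | I \<subseteq> A \<and> card I = i. \<Sum>f | f \<in> I \<rightarrow>\<^sub>E B \<and> inj_on f I. \<Prod>k\<in>I. w (k, f k))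
    = (\<Sum>G | G \<subseteq> A \<times> B \<and> card G = i. if inj_on fst G \<and> inj_on snd G then prod w G else 0)"
proof -
  let ?I = "{I. I \<subseteq> A \<and> card I = i}" and ?F = "\<lambda>I. {f. f \<in> I \<rightarrow>\<^sub>E B \<and> inj_on f I}"
  let ?G = "{G. G \<subseteq> A \<times> B \<and> card G = i \<and> inj_on fst G \<and> inj_on snd G}"
  have finI: "finite I" if "I \<subseteq> A" for I using that A finite_subset by auto
  have "(\<Sum>I\<in>?I. \<Sum>f\<in>?F I. \<Prod>k\<in>I. w (k, f k)) = (\<Sum>q\<in>Sigma ?I ?F. \<Prod>k\<in>fst q. w (k, snd q k))"
  proof (subst sum.Sigma)
    show "finite ?I" by (rule finite_subset[of _ "Pow A"]) (use A in auto)
    show "\<forall>I\<in>?I. finite (?F I)"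
    proof
      fix I assume "I \<in> ?I"
      then have "finite (I \<rightarrow>\<^sub>E B)" using finI B by (intro finite_PiE) auto
      then show "finite (?F I)" by (rule rev_finite_subset) auto
    qed
  qed (simp add: case_prod_unfold)
  also have "\<dots> = (\<Sum>G\<in>?G. prod w G)"
  proof (rule sum.reindex_bij_witness[of _
        "\<lambda>G. (fst ` G, restrict (\<lambda>k. snd (the_inv_into G fst k)) (fst ` G))"
        "\<lambda>q. (\<lambda>k. (k, snd q k)) ` fst q"])
    fix q assume q: "q \<in> Sigma ?I ?F"
    obtain I f where If: "q = (I, f)" by (cases q)
    have I: "I \<subseteq> A" "card I = i" and f: "f \<in> I \<rightarrow>\<^sub>E B" "inj_on f I" using q If by auto
    let ?Gq = "(\<lambda>k. (k, f k)) ` I"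
    have inj: "inj_on (\<lambda>k. (k, f k)) I" by (auto simp: inj_on_def)
    have fstG: "inj_on fst ?Gq" "fst ` ?Gq = I" by (auto simp: inj_on_def image_image)
    have "restrict (\<lambda>k. snd (the_inv_into ?Gq fst k)) I = f"
    proof
      fix k show "restrict (\<lambda>k. snd (the_inv_into ?Gq fst k)) I k = f k"
      proof (cases "k \<in> I")
        case True
        then have "the_inv_into ?Gq fst (fst (k, f k)) = (k, f k)"
          by (intro the_inv_into_f_f fstG) auto
        then show ?thesis using True by simp
      qed (use f(1) PiE_arb[OF f(1)] in auto)
    qed
    then show "(fst ` ((\<lambda>k. (k, snd q k)) ` fst q),
        restrict (\<lambda>k. snd (the_inv_into ((\<lambda>k. (k, snd q k)) ` fst q) fst k)) (fst ` ((\<lambda>k. (k, snd q k)) ` fst q))) = q"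
      by (simp only: If fst_conv snd_conv fstG)
    have "inj_on snd ?Gq" using f(2) by (auto simp: inj_on_def)
    moreover have "?Gq \<subseteq> A \<times> B" using I f by auto
    ultimately show "(\<lambda>k. (k, snd q k)) ` fst q \<in> ?G"
      using fstG card_image[OF inj] I by (simp add: If)
    show "prod w ((\<lambda>k. (k, snd q k)) ` fst q) = (\<Prod>k\<in>fst q. w (k, snd q k))"
      using prod.reindex[OF inj, of w] by (simp add: If)
  next
    fix G assume "G \<in> ?G"
    then have G: "G \<subseteq> A \<times> B" "card G = i" and inj: "inj_on fst G" "inj_on snd G" by auto
    let ?f = "\<lambda>k. snd (the_inv_into G fst k)"
    have f: "?f (fst j) = snd j" if "j \<in> G" for j
      using the_inv_into_f_f[OF inj(1) that] by simp
    have "(\<lambda>k. (k, restrict ?f (fst ` G) k)) ` fst ` G = (\<lambda>j. j) ` G"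
      unfolding image_image by (rule image_cong) (use f in auto)
    then show "(\<lambda>k. (k, snd (fst ` G, restrict ?f (fst ` G)) k)) ` fst (fst ` G, restrict ?f (fst ` G)) = G"
      by simp
    have "inj_on (restrict ?f (fst ` G)) (fst ` G)"
    proof (rule inj_onI)
      fix k k' assume "k \<in> fst ` G" "k' \<in> fst ` G" and eq: "restrict ?f (fst ` G) k = restrict ?f (fst ` G) k'"
      then obtain j j' where j: "j \<in> G" "k = fst j" "j' \<in> G" "k' = fst j'" by auto
      then have "snd j = snd j'" using eq f by simp
      then have "j = j'" using inj_onD[OF inj(2)] j by blast
      then show "k = k'" using j by simp
    qed
    moreover have "restrict ?f (fst ` G) \<in> fst ` G \<rightarrow>\<^sub>E B"
      using f G by (intro PiE_I) auto
    moreover have "fst ` G \<subseteq> A" "card (fst ` G) = i" using G card_image[OF inj(1)] by auto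
    ultimately show "(fst ` G, restrict ?f (fst ` G)) \<in> Sigma ?I ?F" by simp
  qed
  also have "\<dots> = (\<Sum>G | G \<subseteq> A \<times> B \<and> card G = i. if inj_on fst G \<and> inj_on snd G then prod w G else 0)"
  proof (rule sum.mono_neutral_cong_left)
    show "finite {G. G \<subseteq> A \<times> B \<and> card G = i}"
      by (rule finite_subset[of _ "Pow (A \<times> B)"]) (use A B in auto)
  qed auto
  finally show ?thesis .
qed

section \<open>The expected elementary symmetric functions of the Wishart matrix\<close>

text \<open>With \<open>N = P\<^sup>T * X * Q\<close>, the matrix \<open>N * N\<^sup>T\<close> is
  similar to \<open>W\<close>, so the latent roots may be expanded through the minors of
  \<open>N\<close>. Termwise integration leaves \<open>\<pi> = id\<close>, where every selected
  entry appears squared.\<close>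

lemma expectation_Tr_sym_wishart:
  assumes P: "orthogonal_of_order p P" and Q: "orthogonal_of_order n Q" and s: "0 < s" and i: "i \<le> p"
    and W: "wishart \<Omega> p n (s \<cdot>\<^sub>m 1\<^sub>m p) (P * rect_diag p n m * Q\<^sup>T) W"
  shows "(\<integral>\<omega>. Tr_sym i (W \<omega>) \<partial>\<Omega>) = complex_of_real
    (\<Sum>I | I \<subseteq> {..<p} \<and> card I = i. \<Sum>f | f \<in> I \<rightarrow>\<^sub>E {..<n} \<and> inj_on f I.
      \<Prod>k\<in>I. (rect_diag p n m $$ (k, f k))\<^sup>2 + s)"
proof -
  let ?D = "rect_diag p n m" and ?J = "{..<p} \<times> {..<n}"
  let ?I = "{I. I \<subseteq> {..<p} \<and> card I = i}" and ?F = "\<lambda>I. {f. f \<in> I \<rightarrow>\<^sub>E {..<n} \<and> inj_on f I}"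
  \<comment> \<open>A total version of the diagonal mean: \<open>polarized_moment_permuted\<close>
    wants zeros at all off-diagonal pairs, while entries of \<open>rect_diag\<close> are specified
    only within its dimensions.\<close>
  define d :: "nat \<times> nat \<Rightarrow> real" where "d j = (if fst j = snd j then m (fst j) else 0)" for j
  have D: "?D \<in> carrier_mat p n" by (simp add: rect_diag_def)
  have dD: "?D $$ j = d j" if "j \<in> ?J" for j using that by (auto simp: rect_diag_def d_def)
  obtain X where X: "gaussian_matrix \<Omega> p n (P * ?D * Q\<^sup>T) (s \<cdot>\<^sub>m 1\<^sub>m p) X"
    and WX: "\<And>\<omega>. \<omega> \<in> space \<Omega> \<Longrightarrow> W \<omega> = X \<omega> * (X \<omega>)\<^sup>T"
    using W by (auto simp: wishart_def)
  interpret prob_space \<Omega> using X by (simp add: gaussian_matrix_def)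
  define N where "N \<omega> = P\<^sup>T * X \<omega> * Q" for \<omega>
  define R where "R I f \<pi> \<omega> = (\<Prod>k\<in>I. N \<omega> $$ (k, f k)) * (\<Prod>k\<in>I. N \<omega> $$ (\<pi> k, f k))" for I f \<pi> \<omega>
  have c: "P \<in> carrier_mat p p" "Q \<in> carrier_mat n n" "P\<^sup>T * P = 1\<^sub>m p" "P * P\<^sup>T = 1\<^sub>m p" "Q * Q\<^sup>T = 1\<^sub>m n"
    using P Q by (auto simp: orthogonal_of_order_def)
  have Tr: "Tr_sym i (W \<omega>) = complex_of_real (\<Sum>I\<in>?I. \<Sum>f\<in>?F I. \<Sum>\<pi> | \<pi> permutes I. signof \<pi> * R I f \<pi> \<omega>)"
    if "\<omega> \<in> space \<Omega>" for \<omega>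
  proof -
    have Xc: "X \<omega> \<in> carrier_mat p n" using X that by (simp add: gaussian_matrix_def)
    have Nc: "N \<omega> \<in> carrier_mat p n" using c Xc by (auto simp: N_def)
    have PN: "P * N \<omega> = X \<omega> * Q"
    proof -
      have "P * N \<omega> = (P * P\<^sup>T) * (X \<omega> * Q)"
        using c(1,2) Xc by (simp add: N_def assoc_mult_mat[of _ p p _ p _ n] assoc_mult_mat[of _ p p _ n _ n])
      then show ?thesis using c Xc by simp
    qed
    \<comment> \<open>The rotation of the columns cancels through \<open>Q * Q\<^sup>T\<close>; that
      of the rows survives as a similarity by \<open>P\<close>.\<close>
    have "(P * N \<omega>) * (P * N \<omega>)\<^sup>T = X \<omega> * (Q * Q\<^sup>T) * (X \<omega>)\<^sup>T"
      unfolding PN using c(2) Xc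
      by (simp add: transpose_mult[of _ p n _ n] assoc_mult_mat[of _ p n _ n _ n] assoc_mult_mat[of _ p n _ n _ p] assoc_mult_mat[of _ n n _ n _ p])
    then have XX: "X \<omega> * (X \<omega>)\<^sup>T = (P * N \<omega>) * (P * N \<omega>)\<^sup>T" using c Xc by simp
    also have "\<dots> = P * (N \<omega> * (N \<omega>)\<^sup>T) * P\<^sup>T"
      using c(1) Nc by (simp add: transpose_mult[of _ p p _ n] assoc_mult_mat[of _ p p _ n _ p] assoc_mult_mat[of _ p n _ p _ p] assoc_mult_mat[of _ p p _ p _ p])
    finally have "similar_mat_wit (X \<omega> * (X \<omega>)\<^sup>T) (N \<omega> * (N \<omega>)\<^sup>T) P P\<^sup>T"
      using c Xc Nc by (auto simp: similar_mat_wit_def Let_def)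
    then have "char_poly (W \<omega>) = char_poly (N \<omega> * (N \<omega>)\<^sup>T)"
      unfolding WX[OF that] by (intro char_poly_similar) (auto simp: similar_mat_def)
    moreover have "W \<omega> \<in> carrier_mat p p" unfolding WX[OF that] using Xc by auto
    moreover have "N \<omega> * (N \<omega>)\<^sup>T \<in> carrier_mat p p" using Nc by auto
    ultimately have "Tr_sym i (W \<omega>) = complex_of_real
        (\<Sum>I\<in>?I. \<Sum>\<pi> | \<pi> permutes I. signof \<pi> * (\<Prod>k\<in>I. (N \<omega> * (N \<omega>)\<^sup>T) $$ (k, \<pi> k)))"
      by (simp only: Tr_sym_eq_coeff_char_poly[OF _ i] coeff_char_poly_eq_principal_minors[OF _ i])
    also have "(\<Sum>I\<in>?I. \<Sum>\<pi> | \<pi> permutes I. signof \<pi> * (\<Prod>k\<in>I. (N \<omega> * (N \<omega>)\<^sup>T) $$ (k, \<pi> k)))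
        = (\<Sum>I\<in>?I. \<Sum>f\<in>?F I. \<Sum>\<pi> | \<pi> permutes I. signof \<pi> * R I f \<pi> \<omega>)"
      unfolding R_def by (intro sum.cong refl principal_minor_gram[OF Nc]) auto
    finally show ?thesis .
  qed
  have lin: "normal_rv \<Omega> (\<lambda>\<omega>. \<Sum>j\<in>?J. z j * N \<omega> $$ j) (\<Sum>j\<in>?J. z j * d j) (s * (\<Sum>j\<in>?J. (z j)\<^sup>2))" for z
    using gaussian_matrix_rotated_linear_form[OF P Q D X s, of z] dD by (simp add: N_def)
  have R: "has_bochner_integral \<Omega> (R I f \<pi>) (if \<pi> = id then \<Prod>k\<in>I. (?D $$ (k, f k))\<^sup>2 + s else 0)"
    if I: "I \<in> ?I" and f: "f \<in> ?F I" and \<pi>: "\<pi> permutes I" for I f \<pi>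
  proof -
    let ?c = "case_sum (\<lambda>k. (k, f k)) (\<lambda>k. (\<pi> k, f k))"
    have finI: "finite I" using I finite_subset by auto
    have fn: "f k < n" if "k \<in> I" for k using f that by auto
    have \<pi>p: "\<pi> k < p" if "k \<in> I" for k using permutes_in_image[OF \<pi>, of k] I that by auto
    have "?c ` (I <+> I) \<subseteq> ?J" using I fn \<pi>p by auto
    then have "has_bochner_integral \<Omega> (\<lambda>\<omega>. \<Prod>t\<in>I <+> I. N \<omega> $$ (?c t)) (polarized_moment ?J (I <+> I) ?c d s)"
      using finI by (intro has_bochner_integral_prod_gaussian lin) auto
    moreover have "(\<Prod>t\<in>I <+> I. N \<omega> $$ (?c t)) = R I f \<pi> \<omega>" for \<omega>
      unfolding R_def by (subst prod.Plus) (use finI in auto)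
    moreover have "polarized_moment ?J (I <+> I) ?c d s = (if \<pi> = id then \<Prod>k\<in>I. (?D $$ (k, f k))\<^sup>2 + s else 0)"
    proof (cases "\<pi> = id")
      case True
      have "polarized_moment ?J (I <+> I) (case_sum (\<lambda>k. (k, f k)) (\<lambda>k. (k, f k))) d s = (\<Prod>k\<in>I. (d (k, f k))\<^sup>2 + s)"
        using I fn by (intro polarized_moment_squares s finI) (auto simp: inj_on_def)
      also have "\<dots> = (\<Prod>k\<in>I. (?D $$ (k, f k))\<^sup>2 + s)"
      proof (rule prod.cong[OF refl])
        fix k assume "k \<in> I"
        then have "(k, f k) \<in> ?J" using I fn by auto
        then show "(d (k, f k))\<^sup>2 + s = (?D $$ (k, f k))\<^sup>2 + s" by (simp only: dD)
      qed
      finally show ?thesis using True by simp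
    next
      case False
      then show ?thesis using I f by (simp add: polarized_moment_permuted[OF s finI _ _ _ _ _ \<pi>] d_def PiE_def)
    qed
    ultimately show ?thesis by simp
  qed
  have inner: "(\<Sum>\<pi> | \<pi> permutes I. signof \<pi> * (if \<pi> = id then x else 0)) = x"
    if "I \<in> ?I" for I and x :: real
  proof -
    have "finite {\<pi>. \<pi> permutes I}" using that finite_subset by (intro finite_permutations) auto
    then have "(\<Sum>\<pi> | \<pi> permutes I. signof \<pi> * (if \<pi> = id then x else 0)) = (\<Sum>\<pi>\<in>{id}. signof \<pi> * (if \<pi> = id then x else 0))"
      by (intro sum.mono_neutral_right) (auto simp: permutes_id)
    then show ?thesis by simp
  qed
  have "has_bochner_integral \<Omega> (\<lambda>\<omega>. \<Sum>I\<in>?I. \<Sum>f\<in>?F I. \<Sum>\<pi> | \<pi> permutes I. signof \<pi> * R I f \<pi> \<omega>)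
      (\<Sum>I\<in>?I. \<Sum>f\<in>?F I. \<Sum>\<pi> | \<pi> permutes I. signof \<pi> * (if \<pi> = id then \<Prod>k\<in>I. (?D $$ (k, f k))\<^sup>2 + s else 0))"
    by (intro has_bochner_integral_sum has_bochner_integral_mult_right R) auto
  then have "(\<integral>\<omega>. (\<Sum>I\<in>?I. \<Sum>f\<in>?F I. \<Sum>\<pi> | \<pi> permutes I. signof \<pi> * R I f \<pi> \<omega>) \<partial>\<Omega>)
      = (\<Sum>I\<in>?I. \<Sum>f\<in>?F I. \<Prod>k\<in>I. (?D $$ (k, f k))\<^sup>2 + s)"
    by (simp only: has_bochner_integral_iff inner cong: sum.cong)
  moreover have "(\<integral>\<omega>. Tr_sym i (W \<omega>) \<partial>\<Omega>)
      = (\<integral>\<omega>. complex_of_real (\<Sum>I\<in>?I. \<Sum>f\<in>?F I. \<Sum>\<pi> | \<pi> permutes I. signof \<pi> * R I f \<pi> \<omega>) \<partial>\<Omega>)"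
    by (rule Bochner_Integration.integral_cong[OF refl Tr])
  ultimately show ?thesis by (simp only: integral_complex_of_real)
qed

section \<open>The umbral power of the trace\<close>

text \<open>Expand the power over sequences \<open>g\<close> of cells. Row deltas, column deltas and
  Gaussian entries involve disjoint sets of umbrae, so the evaluation factors: the deltas give
  \<open>1\<close> or \<open>0\<close> according to whether rows and columns are distinct, and the
  Gaussian part gives second moments. Each matching arises from \<open>fact i\<close>
  sequences.\<close>

lemma eval_delta_weighted_power:
  fixes N :: "'a \<times> 'b \<Rightarrow> 'u umbral_poly"
  assumes E: "umbral_evaluation E" and v: "0 < v" and A: "finite A" and B: "finite B"
    and delta: "\<And>k. k \<in> A \<Longrightarrow> delta_umbra E (\<delta> k)" "\<And>l. l \<in> B \<Longrightarrow> delta_umbra E (\<delta>' l)"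
    and inj: "inj_on \<delta> A" "inj_on \<delta>' B" and disj: "\<delta> ` A \<inter> \<delta>' ` B = {}"
    and N: "\<And>j. j \<in> A \<times> B \<Longrightarrow> umbrae_of (N j) \<inter> (\<delta> ` A \<union> \<delta>' ` B) = {}"
    and moments: "\<And>z k. E ((\<Sum>j\<in>A \<times> B. uconst (z j) * N j) ^ k)
       = normal_moment (\<Sum>j\<in>A \<times> B. z j * d j) (v * (\<Sum>j\<in>A \<times> B. (z j)\<^sup>2)) k"
  shows "E ((\<Sum>j\<in>A \<times> B. (umbra (\<delta> (fst j)) * N j * umbra (\<delta>' (snd j)))\<^sup>2) ^ i) = fact i *
    (\<Sum>G | G \<subseteq> A \<times> B \<and> card G = i. if inj_on fst G \<and> inj_on snd G then \<Prod>j\<in>G. (d j)\<^sup>2 + v else 0)"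
proof -
  let ?J = "A \<times> B" and ?S = "{..<i}"
  let ?F = "\<lambda>G. if inj_on fst G \<and> inj_on snd G then \<Prod>j\<in>G. (d j)\<^sup>2 + v else 0"
  have J: "finite ?J" using A B by simp
  have summand: "E (\<Prod>t<i. (umbra (\<delta> (fst (g t))) * N (g t) * umbra (\<delta>' (snd (g t))))\<^sup>2)
      = (if inj_on g ?S then ?F (g ` ?S) else 0)" if g: "g \<in> ?S \<rightarrow>\<^sub>E ?J" for g
  proof -
    let ?a = "\<Prod>t<i. (umbra (\<delta> (fst (g t))))\<^sup>2" and ?b = "\<Prod>t<i. (umbra (\<delta>' (snd (g t))))\<^sup>2"
      and ?c = "\<Prod>t<i. (N (g t))\<^sup>2"
    have gA: "fst (g t) \<in> A" "snd (g t) \<in> B" "g t \<in> ?J" if "t < i" for t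
      using PiE_mem[OF g, of t] that by auto
    have ua: "umbrae_of ?a \<subseteq> \<delta> ` A"
    proof
      fix u assume "u \<in> umbrae_of ?a"
      then obtain t where "t < i" "u \<in> umbrae_of ((umbra (\<delta> (fst (g t))))\<^sup>2)"
        using umbrae_of_prod[of "\<lambda>t. (umbra (\<delta> (fst (g t))))\<^sup>2" ?S] by auto
      then show "u \<in> \<delta> ` A" using gA umbrae_of_power[of "umbra (\<delta> (fst (g t)))" 2] by (auto simp: umbrae_of_umbra)
    qed
    have ub: "umbrae_of ?b \<subseteq> \<delta>' ` B"
    proof
      fix u assume "u \<in> umbrae_of ?b"
      then obtain t where "t < i" "u \<in> umbrae_of ((umbra (\<delta>' (snd (g t))))\<^sup>2)"
        using umbrae_of_prod[of "\<lambda>t. (umbra (\<delta>' (snd (g t))))\<^sup>2" ?S] by auto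
      then show "u \<in> \<delta>' ` B" using gA umbrae_of_power[of "umbra (\<delta>' (snd (g t)))" 2] by (auto simp: umbrae_of_umbra)
    qed
    have uc: "umbrae_of ?c \<inter> (\<delta> ` A \<union> \<delta>' ` B) = {}"
    proof -
      have "u \<notin> \<delta> ` A \<union> \<delta>' ` B" if u: "u \<in> umbrae_of ?c" for u
      proof -
        obtain t where "t < i" "u \<in> umbrae_of ((N (g t))\<^sup>2)"
          using umbrae_of_prod[of "\<lambda>t. (N (g t))\<^sup>2" ?S] u by auto
        then show ?thesis using N[OF gA(3)] umbrae_of_power[of "N (g t)" 2] by blast
      qed
      then show ?thesis by blast
    qed
    have a: "E ?a = (if inj_on (\<lambda>t. \<delta> (fst (g t))) ?S then 1 else 0)"
      using gA delta by (intro eval_prod_delta_squares[OF E]) auto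
    have b: "E ?b = (if inj_on (\<lambda>t. \<delta>' (snd (g t))) ?S then 1 else 0)"
      using gA delta by (intro eval_prod_delta_squares[OF E]) auto
    have ia: "inj_on (\<lambda>t. \<delta> (fst (g t))) ?S \<longleftrightarrow> inj_on (\<lambda>t. fst (g t)) ?S"
      using inj(1) gA by (auto simp: inj_on_def)
    have ib: "inj_on (\<lambda>t. \<delta>' (snd (g t))) ?S \<longleftrightarrow> inj_on (\<lambda>t. snd (g t)) ?S"
      using inj(2) gA by (auto simp: inj_on_def)
    have "(\<Prod>t<i. (umbra (\<delta> (fst (g t))) * N (g t) * umbra (\<delta>' (snd (g t))))\<^sup>2) = ?a * (?b * ?c)"
      by (simp add: power_mult_distrib prod.distrib mult_ac)
    moreover have "E (?a * (?b * ?c)) = E ?a * E (?b * ?c)"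
      by (rule eval_mult_disjoint[OF E]) (use ua ub uc disj umbrae_of_mult[of ?b ?c] in blast)
    moreover have "E (?b * ?c) = E ?b * E ?c"
      by (rule eval_mult_disjoint[OF E]) (use ub uc in blast)
    ultimately have prod: "E (\<Prod>t<i. (umbra (\<delta> (fst (g t))) * N (g t) * umbra (\<delta>' (snd (g t))))\<^sup>2)
        = (if inj_on (\<lambda>t. fst (g t)) ?S \<and> inj_on (\<lambda>t. snd (g t)) ?S then E ?c else 0)"
      unfolding a b ia ib by simp
    show ?thesis
    proof (cases "inj_on g ?S")
      case True
      have cg: "case_sum g g ` (?S <+> ?S) \<subseteq> ?J"
        by (rule image_subsetI, erule PlusE) (simp_all add: gA(3))
      have "?c = (\<Prod>t\<in>?S <+> ?S. N (case_sum g g t))"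
        by (subst prod.Plus) (auto simp: power2_eq_square prod.distrib)
      then have "E ?c = polarized_moment ?J (?S <+> ?S) (case_sum g g) d v"
        using cg by (simp only:) (intro eval_prod_gaussian[OF E moments J], simp_all)
      also have "\<dots> = (\<Prod>t<i. (d (g t))\<^sup>2 + v)"
        by (intro polarized_moment_squares v J True image_subsetI gA(3)) simp_all
      also have "\<dots> = (\<Prod>j\<in>g ` ?S. (d j)\<^sup>2 + v)"
        using True by (simp add: prod.reindex)
      finally have c: "E ?c = (\<Prod>j\<in>g ` ?S. (d j)\<^sup>2 + v)" .
      have "inj_on fst (g ` ?S) \<longleftrightarrow> inj_on (\<lambda>t. fst (g t)) ?S" "inj_on snd (g ` ?S) \<longleftrightarrow> inj_on (\<lambda>t. snd (g t)) ?S"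
        using True comp_inj_on_iff[OF True, of fst] comp_inj_on_iff[OF True, of snd] by (simp_all add: comp_def)
      then show ?thesis using True unfolding prod c by simp
    next
      case False
      \<comment> \<open>A repeated cell repeats its row, so the row deltas already make the term
        vanish and no higher Gaussian moment enters.\<close>
      then have "\<not> inj_on (\<lambda>t. fst (g t)) ?S"
        using inj_on_imageI2[of fst g ?S] by (auto simp: comp_def)
      then show ?thesis using False unfolding prod by simp
    qed
  qed
  have "E ((\<Sum>j\<in>?J. (umbra (\<delta> (fst j)) * N j * umbra (\<delta>' (snd j)))\<^sup>2) ^ i)
      = (\<Sum>g\<in>?S \<rightarrow>\<^sub>E ?J. if inj_on g ?S then ?F (g ` ?S) else 0)"
    unfolding sum_power_eq_PiE[OF J] eval_sum[OF E] by (rule sum.cong[OF refl summand])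
  also have "\<dots> = (\<Sum>g | g \<in> ?S \<rightarrow>\<^sub>E ?J \<and> inj_on g ?S. ?F (g ` ?S))"
  proof (rule sum.mono_neutral_cong_right)
    show "finite (?S \<rightarrow>\<^sub>E ?J)" using J by (intro finite_PiE) auto
  qed auto
  also have "\<dots> = fact i * (\<Sum>G | G \<subseteq> ?J \<and> card G = i. ?F G)"
    unfolding sum_inj_PiE[OF J, of ?F] by simp
  finally show ?thesis .
qed

section \<open>Equality of the two evaluations\<close>

theorem corollary5p4:
  fixes p n i :: nat
    and \<sigma> :: real
    and m :: "nat \<Rightarrow> real"
    and P Q M :: "real mat"
    and E :: "'u umbral_poly \<Rightarrow> real"
    and X :: "'u umbral_poly mat"
    and \<delta> \<delta>' :: "nat \<Rightarrow> 'u"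
    and \<Omega> :: "'w measure"
    and W :: "'w \<Rightarrow> real mat"
  assumes "1 \<le> p" and "p \<le> n" and "\<sigma>\<^sup>2 > 0"
    and "orthogonal_of_order p P" and "orthogonal_of_order n Q"
    and "M = P * rect_diag p n m * Q\<^sup>T"
    and "umbral_evaluation E"
    and "normal_umbral_matrix E p n M (\<sigma>\<^sup>2 \<cdot>\<^sub>m 1\<^sub>m p) X"
    and "wishart \<Omega> p n (\<sigma>\<^sup>2 \<cdot>\<^sub>m 1\<^sub>m p) M W"
    and "\<And>k. k < p \<Longrightarrow> delta_umbra E (\<delta> k)"
    and "\<And>l. l < n \<Longrightarrow> delta_umbra E (\<delta>' l)"
    and "inj_on \<delta> {..<p}" and "inj_on \<delta>' {..<n}"
    and "\<delta> ` {..<p} \<inter> \<delta>' ` {..<n} = {}"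
    and "\<And>k l. k < p \<Longrightarrow> l < n \<Longrightarrow>
           umbrae_of (X $$ (k, l)) \<inter> (\<delta> ` {..<p} \<union> \<delta>' ` {..<n}) = {}"
    and "i \<le> p"
  defines "Y \<equiv> mat_diag p (\<lambda>k. umbra (\<delta> k)) * map_mat uconst (P\<^sup>T) * X * map_mat uconst Q
                 * mat_diag n (\<lambda>l. umbra (\<delta>' l))"
  shows "fact i * (\<integral>\<omega>. Tr_sym i (W \<omega>) \<partial>\<Omega>) = complex_of_real (E (mtrace (Y * Y\<^sup>T) ^ i))"
proof -
  let ?J = "{..<p} \<times> {..<n}" and ?D = "rect_diag p n m"
  let ?N = "map_mat uconst (P\<^sup>T) * X * map_mat uconst Q"
  have c: "P \<in> carrier_mat p p" "Q \<in> carrier_mat n n"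
    using assms(4,5) by (auto simp: orthogonal_of_order_def)
  have D: "?D \<in> carrier_mat p n" by (simp add: rect_diag_def)
  have X: "X \<in> carrier_mat p n" using assms(8) by (simp add: normal_umbral_matrix_def)
  have N: "?N \<in> carrier_mat p n" using c X by auto
  \<comment> \<open>Reassociation exposes the rotated matrix between the two diagonal factors, which
    merely scale its rows and columns by the delta umbrae.\<close>
  have "Y = mat_diag p (\<lambda>k. umbra (\<delta> k)) * ?N * mat_diag n (\<lambda>l. umbra (\<delta>' l))"
    unfolding Y_def using c X
    by (simp add: assoc_mult_mat[of _ p p _ p _ n] assoc_mult_mat[of _ p p _ n _ n] assoc_mult_mat[of _ p n _ n _ n])
  then have Y: "Y = Matrix.mat p n (\<lambda>(k, l). umbra (\<delta> k) * ?N $$ (k, l) * umbra (\<delta>' l))"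
    using N by (auto simp: mat_diag_mult_left[of _ p n] mat_diag_mult_right[of _ p n] intro!: eq_matI)
  have "mtrace (Y * Y\<^sup>T) = mtrace ((Y\<^sup>T)\<^sup>T * Y\<^sup>T)" by simp
  also have "\<dots> = (\<Sum>j\<in>{..<n} \<times> {..<p}. Y\<^sup>T $$ j * Y\<^sup>T $$ j)"
    by (rule mtrace_transpose_mult) (simp_all add: Y)
  also have "\<dots> = (\<Sum>l<n. \<Sum>k<p. (Y $$ (k, l))\<^sup>2)"
    unfolding sum.cartesian_product by (rule sum.cong) (auto simp: Y power2_eq_square)
  also have "\<dots> = (\<Sum>j\<in>?J. (umbra (\<delta> (fst j)) * ?N $$ j * umbra (\<delta>' (snd j)))\<^sup>2)"
    by (subst sum.swap, unfold sum.cartesian_product, rule sum.cong) (auto simp: Y)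
  finally have trace: "mtrace (Y * Y\<^sup>T) = (\<Sum>j\<in>?J. (umbra (\<delta> (fst j)) * ?N $$ j * umbra (\<delta>' (snd j)))\<^sup>2)" .
  have umbrae: "umbrae_of (?N $$ j) \<inter> (\<delta> ` {..<p} \<union> \<delta>' ` {..<n}) = {}" if "j \<in> ?J" for j
  proof -
    let ?t = "\<lambda>r. map_mat uconst (P\<^sup>T) $$ (fst j, fst r) * X $$ r * map_mat uconst Q $$ (snd r, snd j)"
    have "?N $$ (fst j, snd j) = (\<Sum>r\<in>?J. ?t r)"
      by (rule index_mult_mat_3) (use c X that in auto)
    then have "umbrae_of (?N $$ j) \<subseteq> (\<Union>r\<in>?J. umbrae_of (?t r))"
      using umbrae_of_sum[of ?t ?J] by simp
    moreover have "umbrae_of (?t r) \<subseteq> umbrae_of (X $$ r)" if "r \<in> ?J" for r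
    proof -
      have "?t r = uconst (P\<^sup>T $$ (fst j, fst r)) * X $$ r * uconst (Q $$ (snd r, snd j))"
        using \<open>j \<in> ?J\<close> that c by auto
      then show ?thesis
        using umbrae_of_mult[of "uconst (P\<^sup>T $$ (fst j, fst r)) * X $$ r" "uconst (Q $$ (snd r, snd j))"]
          umbrae_of_mult[of "uconst (P\<^sup>T $$ (fst j, fst r))" "X $$ r"]
        by (auto simp: umbrae_of_uconst)
    qed
    moreover have "umbrae_of (X $$ r) \<inter> (\<delta> ` {..<p} \<union> \<delta>' ` {..<n}) = {}" if "r \<in> ?J" for r
      using assms(15)[of "fst r" "snd r"] that by (simp add: mem_Times_iff)
    ultimately show ?thesis by blast
  qed
  have "E (mtrace (Y * Y\<^sup>T) ^ i) = fact i *
      (\<Sum>G | G \<subseteq> ?J \<and> card G = i. if inj_on fst G \<and> inj_on snd G then \<Prod>j\<in>G. (?D $$ j)\<^sup>2 + \<sigma>\<^sup>2 else 0)"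
    unfolding trace
  proof (rule eval_delta_weighted_power[OF assms(7) assms(3) _ _ _ _ assms(12-14) umbrae])
    show "E ((\<Sum>j\<in>?J. uconst (z j) * ?N $$ j) ^ k)
        = normal_moment (\<Sum>j\<in>?J. z j * ?D $$ j) (\<sigma>\<^sup>2 * (\<Sum>j\<in>?J. (z j)\<^sup>2)) k" for z k
      using normal_umbral_matrix_rotated_moments[OF assms(4,5) D] assms(8) by (simp add: assms(6))
  qed (use assms(10,11) in auto)
  \<comment> \<open>Matchings are the graphs of partial injections; this brings the sum into the
    form found for the expectation.\<close>
  also have "\<dots> = fact i * (\<Sum>I | I \<subseteq> {..<p} \<and> card I = i. \<Sum>f | f \<in> I \<rightarrow>\<^sub>E {..<n} \<and> inj_on f I.
      \<Prod>k\<in>I. (?D $$ (k, f k))\<^sup>2 + \<sigma>\<^sup>2)"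
    by (simp only: sum_partial_injections_eq_sum_matchings[OF finite_lessThan finite_lessThan, where w = "\<lambda>j. (?D $$ j)\<^sup>2 + \<sigma>\<^sup>2"])
  finally show ?thesis
    using expectation_Tr_sym_wishart[OF assms(4,5,3,16)] assms(9) by (simp add: assms(6))
qed

end
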